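(* Let $n\geq2$. No closed $1$-leafed elastica in $\mathbf{R}^n$ exists. A closed $2$-leafed elastica in $\mathbf{R}^n$ is, up to similarity and reparameterization, uniquely given by a (one-fold closed) figure-eight elastica.
   Context: $\mathbf{T}^1:=\mathbf{R}/\mathbf{Z}$; $H^2=W^{2,2}$, and $H^2\hookrightarrow C^1$, so a curve is immersed if its derivative is nowhere zero. For $m\in(0,1)$ let $F(x,m)=\int_0^x\frac{d\theta}{\sqrt{1-m\sin^2\theta}}$, $K(m)=F(\pi/2,m)$, $E(m)=\int_0^{\pi/2}\sqrt{1-m\sin^2\theta}\,d\theta$, $\operatorname{am}(\cdot,m):=F^{-1}(\cdot,m)$ on $\mathbf{R}$, $\operatorname{cn}(x,m):=\cos(\operatorname{am}(x,m))$. Let $m^*\in(0,1)$ be the unique parameter with $K(m^* )=2E(m^* )$. For a positive integer $N$, an $\frac{N}{2}$-fold figure-eight elastica is an immersed curve $\gamma:[a,b]\to\mathbf{R}^n$ that is contained in a plane and whose signed curvature in that plane, as a function of arclength $s\in[0,L]$ ($L$ its length), is up to the choice of sign $\mathrm{k}(s)=2\sqrt{m^*}\Lambda\operatorname{cn}(\Lambda s-K(m^* ),m^* )$ with $\Lambda=2K(m^* )N/L$; half-fold means $N=1$. A (one-fold closed) figure-eight elastica is a closed $H^2$-curve $\gamma:\mathbf{T}^1\to\mathbf{R}^n$ such that for some $t_0\in\mathbf{T}^1$ the curve $\tilde\gamma:[0,1]\to\mathbf{R}^n$, $\tilde\gamma(t):=\gamma(t+t_0)$, is a $1$-fold (i.e.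 $N=2$) figure-eight elastica. An immersed $H^2$-curve $\gamma:[a,b]\to\mathbf{R}^n$ is a $k$-leafed elastica if there are $a=a_0<a_1<\dots<a_k=b$ such that each $\gamma|_{[a_{i-1},a_i]}$, $i=1,\dots,k$, is a half-fold figure-eight elastica and all these $k$ pieces have the same length. A closed $H^2$-curve $\gamma:\mathbf{T}^1\to\mathbf{R}^n$ is a closed $k$-leafed elastica if there is $t_0\in\mathbf{T}^1$ such that $\tilde\gamma:[0,1]\to\mathbf{R}^n$, $\tilde\gamma(t):=\gamma(t+t_0)$, is a $k$-leafed elastica. *)

theory Defs
  imports "HOL-Analysis.Analysis"
begin

text \<open>The interval integral is oriented, so \<open>ellF\<close> is defined for negative \<open>x\<close> as well.
  The second argument is the parameter \<open>m\<close> (not the modulus).\<close>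

definition ellF :: "real \<Rightarrow> real \<Rightarrow> real" where
  "ellF x m = (LBINT \<theta>=0..ereal x. 1 / sqrt (1 - m * (sin \<theta>)\<^sup>2))"

definition ellK :: "real \<Rightarrow> real" where
  "ellK m = ellF (pi / 2) m"

definition ellE :: "real \<Rightarrow> real" where
  "ellE m = (LBINT \<theta>=0..ereal (pi / 2). sqrt (1 - m * (sin \<theta>)\<^sup>2))"

definition am :: "real \<Rightarrow> real \<Rightarrow> real" where
  "am x m = inv (\<lambda>\<phi>. ellF \<phi> m) x"

definition cn :: "real \<Rightarrow> real \<Rightarrow> real" where
  "cn x m = cos (am x m)"

definition mstar :: real where
  "mstar = (THE m. 0 < m \<and> m < 1 \<and> ellK m = 2 * ellE m)"

definition L2_on :: "real \<Rightarrow> real \<Rightarrow> (real \<Rightarrow> 'a::euclidean_space) \<Rightarrow> bool" where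
  "L2_on a b u \<longleftrightarrow> set_borel_measurable lborel {a..b} u \<and>
     set_integrable lborel {a..b} (\<lambda>t. (norm (u t))\<^sup>2)"

text \<open>\<open>\<phi>\<close> belongs to \<open>C\<^sub>c\<^sup>1(a,b)\<close> (extended by zero to the line) and has derivative \<open>\<phi>'\<close>.\<close>

definition C1c_on :: "real \<Rightarrow> real \<Rightarrow> (real \<Rightarrow> real) \<Rightarrow> (real \<Rightarrow> real) \<Rightarrow> bool" where
  "C1c_on a b \<phi> \<phi>' \<longleftrightarrow> (\<forall>t. (\<phi> has_real_derivative \<phi>' t) (at t)) \<and> continuous_on UNIV \<phi>' \<and>
     (\<exists>c d. a < c \<and> c < d \<and> d < b \<and> (\<forall>t. t \<notin> {c..d} \<longrightarrow> \<phi> t = 0))"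

definition weak_deriv_on ::
  "real \<Rightarrow> real \<Rightarrow> (real \<Rightarrow> 'a::euclidean_space) \<Rightarrow> (real \<Rightarrow> 'a) \<Rightarrow> bool" where
  "weak_deriv_on a b u g \<longleftrightarrow> (\<forall>\<phi> \<phi>'. C1c_on a b \<phi> \<phi>' \<longrightarrow>
     (LINT t:{a..b}|lborel. \<phi>' t *\<^sub>R u t) = - (LINT t:{a..b}|lborel. \<phi> t *\<^sub>R g t))"

text \<open>Sobolev functions on an interval are identified with their continuous representatives.\<close>

definition H2_on :: "real \<Rightarrow> real \<Rightarrow> (real \<Rightarrow> 'a::euclidean_space) \<Rightarrow> bool" where
  "H2_on a b \<gamma> \<longleftrightarrow> continuous_on {a..b} \<gamma> \<and> L2_on a b \<gamma> \<and>
     (\<exists>g h. L2_on a b g \<and> L2_on a b h \<and> weak_deriv_on a b \<gamma> g \<and> weak_deriv_on a b g h)"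

text \<open>Curves on \<open>[a,b]\<close> are total functions whose values outside \<open>[a,b]\<close> are irrelevant; hence
  derivatives are taken within \<open>[a,b]\<close>, i.e. one-sidedly at the end points.\<close>

definition immersed_on :: "real \<Rightarrow> real \<Rightarrow> (real \<Rightarrow> 'a::euclidean_space) \<Rightarrow> bool" where
  "immersed_on a b \<gamma> \<longleftrightarrow> (\<exists>\<gamma>'. continuous_on {a..b} \<gamma>' \<and>
     (\<forall>t\<in>{a..b}. (\<gamma> has_vector_derivative \<gamma>' t) (at t within {a..b}) \<and> \<gamma>' t \<noteq> 0))"

text \<open>A curve on the circle \<open>\<real>/\<int>\<close> is a 1-periodic function on the line.\<close>

definition closed_H2_curve :: "(real \<Rightarrow> 'a::euclidean_space) \<Rightarrow> bool" where
  "closed_H2_curve \<gamma> \<longleftrightarrow> (\<forall>t. \<gamma> (t + 1) = \<gamma> t) \<and> (\<forall>a b. a < b \<longrightarrow> H2_on a b \<gamma>)"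

definition arclength :: "real \<Rightarrow> real \<Rightarrow> (real \<Rightarrow> 'a::euclidean_space) \<Rightarrow> real \<Rightarrow> real" where
  "arclength a b \<gamma> t = integral {a..t} (\<lambda>u. norm (vector_derivative \<gamma> (at u within {a..b})))"

definition curve_length :: "real \<Rightarrow> real \<Rightarrow> (real \<Rightarrow> 'a::euclidean_space) \<Rightarrow> real" where
  "curve_length a b \<gamma> = arclength a b \<gamma> b"

text \<open>\<open>e\<^sub>1, e\<^sub>2\<close> is an orthonormal basis of the direction of the plane through \<open>p\<close>, oriented by
  this ordered basis; \<open>rot90\<close> is the rotation by \<open>\<pi>/2\<close> in that plane.\<close>

definition rot90 :: "'a::euclidean_space \<Rightarrow> 'a \<Rightarrow> 'a \<Rightarrow> 'a" where
  "rot90 e1 e2 v = (v \<bullet> e1) *\<^sub>R e2 - (v \<bullet> e2) *\<^sub>R e1"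

definition in_plane ::
  "'a::euclidean_space \<Rightarrow> 'a \<Rightarrow> 'a \<Rightarrow> real \<Rightarrow> real \<Rightarrow> (real \<Rightarrow> 'a) \<Rightarrow> bool" where
  "in_plane p e1 e2 a b \<gamma> \<longleftrightarrow> norm e1 = 1 \<and> norm e2 = 1 \<and> e1 \<bullet> e2 = 0 \<and>
     (\<forall>t\<in>{a..b}. \<gamma> t - p \<in> span {e1, e2})"

text \<open>\<open>c\<close> is the arclength parameterization of \<open>\<gamma>\<close>, \<open>T\<close> its unit tangent, and the signed curvature
  \<open>k\<close> is defined by \<open>T' = k N\<close> with \<open>N\<close> the rotated tangent. The derivative of \<open>T\<close> is required
  everywhere; this is no restriction for a continuous \<open>k\<close>.\<close>

definition has_signed_curvature ::
  "'a::euclidean_space \<Rightarrow> 'a \<Rightarrow> real \<Rightarrow> real \<Rightarrow> (real \<Rightarrow> 'a) \<Rightarrow> (real \<Rightarrow> real) \<Rightarrow> bool" where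
  "has_signed_curvature e1 e2 a b \<gamma> k \<longleftrightarrow> (\<exists>c T.
     (\<forall>t\<in>{a..b}. \<gamma> t = c (arclength a b \<gamma> t)) \<and>
     (\<forall>s\<in>{0..curve_length a b \<gamma>}.
        (c has_vector_derivative T s) (at s within {0..curve_length a b \<gamma>}) \<and>
        (T has_vector_derivative k s *\<^sub>R rot90 e1 e2 (T s)) (at s within {0..curve_length a b \<gamma>})))"

definition fig8_curvature :: "nat \<Rightarrow> real \<Rightarrow> real \<Rightarrow> real" where
  "fig8_curvature N L s = (let \<Lambda> = 2 * ellK mstar * real N / L in
     2 * sqrt mstar * \<Lambda> * cn (\<Lambda> * s - ellK mstar) mstar)"

text \<open>\<open>N\<close> counts half-folds, so \<open>N = 1\<close> is one leaf and \<open>N = 2\<close> a full figure-eight. Only the class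
  \<open>C\<^sup>1\<close> of the parameterization is required; membership in \<open>H\<^sup>2\<close> is imposed where it is used.\<close>

definition fig8_elastica :: "nat \<Rightarrow> real \<Rightarrow> real \<Rightarrow> (real \<Rightarrow> 'a::euclidean_space) \<Rightarrow> bool" where
  "fig8_elastica N a b \<gamma> \<longleftrightarrow> 0 < N \<and> a < b \<and> immersed_on a b \<gamma> \<and>
     (\<exists>p e1 e2. in_plane p e1 e2 a b \<gamma> \<and> (\<exists>\<sigma>\<in>{1, -1}.
        has_signed_curvature e1 e2 a b \<gamma> (\<lambda>s. \<sigma> * fig8_curvature N (curve_length a b \<gamma>) s)))"

definition closed_fig8_elastica :: "(real \<Rightarrow> 'a::euclidean_space) \<Rightarrow> bool" where
  "closed_fig8_elastica \<gamma> \<longleftrightarrow> closed_H2_curve \<gamma> \<and> (\<exists>t0. fig8_elastica 2 0 1 (\<lambda>t. \<gamma> (t + t0)))"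

definition leafed_elastica :: "nat \<Rightarrow> real \<Rightarrow> real \<Rightarrow> (real \<Rightarrow> 'a::euclidean_space) \<Rightarrow> bool" where
  "leafed_elastica k a b \<gamma> \<longleftrightarrow> a < b \<and> H2_on a b \<gamma> \<and> immersed_on a b \<gamma> \<and>
     (\<exists>x :: nat \<Rightarrow> real. x 0 = a \<and> x k = b \<and> (\<forall>i<k. x i < x (Suc i)) \<and>
        (\<forall>i<k. fig8_elastica 1 (x i) (x (Suc i)) \<gamma>) \<and>
        (\<exists>l. \<forall>i<k. curve_length (x i) (x (Suc i)) \<gamma> = l))"

definition closed_leafed_elastica :: "nat \<Rightarrow> (real \<Rightarrow> 'a::euclidean_space) \<Rightarrow> bool" where
  "closed_leafed_elastica k \<gamma> \<longleftrightarrow> closed_H2_curve \<gamma> \<and> (\<exists>t0. leafed_elastica k 0 1 (\<lambda>t. \<gamma> (t + t0)))"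

definition similarity :: "('a::euclidean_space \<Rightarrow> 'a) \<Rightarrow> bool" where
  "similarity S \<longleftrightarrow> (\<exists>c Q v. 0 < c \<and> orthogonal_transformation Q \<and> S = (\<lambda>x. c *\<^sub>R Q x + v))"

text \<open>\<open>\<phi>\<close> is the lift to the line of an orientation preserving \<open>C\<^sup>1\<close>-diffeomorphism of \<open>\<real>/\<int>\<close>.
  A \<open>C\<^sup>1\<close>-diffeomorphism relating two immersed \<open>H\<^sup>2\<close>-curves is automatically of class \<open>H\<^sup>2\<close>.\<close>

definition circle_reparam :: "(real \<Rightarrow> real) \<Rightarrow> bool" where
  "circle_reparam \<phi> \<longleftrightarrow> (\<forall>t. \<phi> (t + 1) = \<phi> t + 1) \<and>
     (\<exists>\<phi>'. continuous_on UNIV \<phi>' \<and> (\<forall>t. (\<phi> has_real_derivative \<phi>' t) (at t) \<and> 0 < \<phi>' t))"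

definition similar_up_to_reparam ::
  "(real \<Rightarrow> 'a::euclidean_space) \<Rightarrow> (real \<Rightarrow> 'a) \<Rightarrow> bool" where
  "similar_up_to_reparam \<gamma> \<delta> \<longleftrightarrow> (\<exists>S \<phi>. similarity S \<and> circle_reparam \<phi> \<and> \<gamma> = S \<circ> \<delta> \<circ> \<phi>)"

end

(*
  A leaf is parameterized explicitly: in units where the curvature is 2 sqrt(m) cn, an elastica with
  this curvature is (2 E(am u, m) - u, -2 sqrt(m) cn u), and K(m) = 2 E(m) says precisely that the two
  ends u = -K, K of a leaf coincide. Its end tangents are (1 - 2m, -+ 2 sqrt(m) sqrt(1 - m)) in the
  frame of the leaf. They differ, so one leaf cannot close up in a C^1 way, and since m* > 1/2 they are
  linearly independent and determine the frame. In a closed curve with two leaves each leaf starts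
  with the end tangent of the other one, so the frame of the second leaf is the reflected frame of the
  first, and this is how the elastica continues beyond u = K. Passing to the closed curve uses that an
  H^2 curve has no corner at the base point, which one sees by testing with rescaled bumps.
*)

theory Submission
  imports Defs
begin

section \<open>Elliptic functions and the explicit elastica\<close>

text \<open>\<open>am\<close> is an \<open>inv\<close> and \<open>mstar\<close> a
  \<open>THE\<close>, so neither can be used until F is known to be bijective and K = 2E to be
  uniquely solvable. A second obstacle is that a leaf is given only by its curvature: tangent and
  position have to be recovered up to a rigid motion. No uniqueness theorem for differential
  equations is invoked; the tangent and the model tangent solve the same linear rotation system, and
  two bilinear expressions in them are constant. The third obstacle is the base point of the circle,
  where the pieces supply one-sided derivatives only and the Sobolev condition has to connect them.
  Uniqueness is then symmetric: a figure-eight is itself 2-leafed, so both curves have the same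
  normal form, and two normal forms differ by a scale, a translation, an orthogonal map of frames
  and a matching of arclengths.\<close>

lemma DERIV_LBINT_from_0:
  fixes f :: "real \<Rightarrow> real"
  assumes "continuous_on UNIV f"
  shows "((\<lambda>x. LBINT y=0..ereal x. f y) has_real_derivative f x) (at x)"
proof -
  \<comment> \<open>The window contains 0 and has x in its interior, so the derivative within it
    becomes two-sided.\<close>
  define a where "a = - \<bar>x\<bar> - 1"
  define b where "b = \<bar>x\<bar> + 1"
  have "((\<lambda>u. LBINT y=ereal 0..ereal u. f y) has_vector_derivative f x) (at x within {a..b})"
    by (rule interval_integral_FTC2) (auto simp: a_def b_def intro: continuous_on_subset[OF assms])
  then have "((\<lambda>u. LBINT y=ereal 0..ereal u. f y) has_vector_derivative f x) (at x within {a<..<b})"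
    by (rule has_vector_derivative_within_subset) auto
  then have "((\<lambda>u. LBINT y=ereal 0..ereal u. f y) has_vector_derivative f x) (at x)"
    by (subst (asm) has_vector_derivative_within_open) (auto simp: a_def b_def)
  then show ?thesis
    by (simp add: has_real_derivative_iff_has_vector_derivative zero_ereal_def)
qed

text \<open>A lower bound on the derivative makes f expanding, hence injective and unbounded in both
  directions, hence onto; the inverse is Lipschitz with constant 1/c, so the inverse function rule
  applies everywhere. This serves both the amplitude (c = 1) and the matching of the arclengths of
  two closed curves.\<close>

lemma real_expanding_diffeo:
  fixes f f' :: "real \<Rightarrow> real"
  assumes D: "\<And>x. (f has_real_derivative f' x) (at x)" and c: "0 < c" "\<And>x. c \<le> f' x"
  shows "f (inv f y) = y" and "inv f (f x) = x"
    and "(inv f has_real_derivative 1 / f' (inv f y)) (at y)"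
proof -
  have mv: "c * (z - w) \<le> f z - f w" if "w \<le> z" for w z
  proof (cases "w = z")
    case False
    with that have "w < z" by simp
    from MVT2[OF this, of f f'] D obtain t where "f z - f w = (z - w) * f' t" by auto
    with \<open>w < z\<close> c(2)[of t] show ?thesis by (simp add: mult.commute mult_left_mono)
  qed simp
  have inj: "inj f"
  proof (rule injI)
    fix w z assume "f w = f z"
    with mv[of w z] mv[of z w] have "\<not> w < z" "\<not> z < w"
      using c(1) by (auto simp: mult_le_0_iff)
    then show "w = z" by simp
  qed
  have cont: "isCont f x" for x using D DERIV_isCont by blast
  have surj: "surj f"
    unfolding surj_def
  proof
    fix y
    \<comment> \<open>With this r, expansion from 0 guarantees that the values at -r and r enclose
      y.\<close>
    define r where "r = \<bar>y - f 0\<bar> / c"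
    have r: "0 \<le> r" "c * r = \<bar>y - f 0\<bar>" using c(1) by (auto simp: r_def)
    have "f (-r) \<le> y" "y \<le> f r"
      using mv[of 0 r] mv[of "-r" 0] r by (auto simp: algebra_simps)
    then have "\<exists>x. -r \<le> x \<and> x \<le> r \<and> f x = y" using r cont by (intro IVT) auto
    then show "\<exists>x. y = f x" by blast
  qed
  show inv1: "f (inv f y) = y" for y using surj by (rule surj_f_inv_f)
  show "inv f (f x) = x" using inj by simp
  have lip: "\<bar>inv f y - inv f z\<bar> \<le> \<bar>y - z\<bar> / c" for y z
  proof -
    have "c * \<bar>inv f y - inv f z\<bar> \<le> \<bar>y - z\<bar>"
      using mv[of "inv f y" "inv f z"] mv[of "inv f z" "inv f y"]
      by (cases "inv f y \<le> inv f z") (auto simp: inv1 abs_if algebra_simps)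
    then show ?thesis using c(1) by (simp add: pos_le_divide_eq mult.commute)
  qed
  have "isCont (inv f) y"
    unfolding isCont_def
  proof (rule LIM_I)
    fix e :: real assume "0 < e"
    show "\<exists>s>0. \<forall>x. x \<noteq> y \<and> norm (x - y) < s \<longrightarrow> norm (inv f x - inv f y) < e"
    proof (intro exI[of _ "c * e"] conjI allI impI)
      show "0 < c * e" using c \<open>0 < e\<close> by simp
      fix x assume "x \<noteq> y \<and> norm (x - y) < c * e"
      then have "\<bar>x - y\<bar> / c < e" using c by (simp add: pos_divide_less_eq mult.commute)
      with lip[of x y] show "norm (inv f x - inv f y) < e" by simp
    qed
  qed
  then show "(inv f has_real_derivative 1 / f' (inv f y)) (at y)"
    using has_field_derivative_inverse_basic[of f "f' (inv f y)" "inv f" y UNIV] D c inv1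
    by (metis UNIV_I inverse_eq_divide less_le_not_le open_UNIV)
qed

text \<open>Takes the place of substitution in integrals: symmetry and translation laws of the
  elliptic integrals follow by comparing derivatives and one value.\<close>

lemma eq_of_same_derivative:
  fixes f g :: "real \<Rightarrow> real"
  assumes "\<And>x. (f has_real_derivative f' x) (at x)" "\<And>x. (g has_real_derivative f' x) (at x)"
    and "f a = g a"
  shows "f x = g x"
proof -
  have "((\<lambda>x. f x - g x) has_real_derivative 0) (at x)" for x
    using DERIV_diff[OF assms(1,2)] by simp
  then have "f x - g x = f a - g a" by (intro DERIV_isconst_all[of "\<lambda>x. f x - g x"]) blast
  with assms(3) show ?thesis by simp
qed

text \<open>The incomplete elliptic integral of the second kind. The parameter comes first so that
  \<open>ellEinc m\<close> is itself a function to differentiate.\<close>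

definition ellEinc :: "real \<Rightarrow> real \<Rightarrow> real" where
  "ellEinc m x = (LBINT \<theta>=0..ereal x. sqrt (1 - m * (sin \<theta>)\<^sup>2))"

lemma ellE_eq_ellEinc: "ellE m = ellEinc m (pi / 2)"
  by (simp add: ellE_def ellEinc_def)

context
  fixes m :: real
  assumes m: "0 < m" "m < 1"
begin

lemma delta_bounds: "1 - m \<le> 1 - m * (sin \<theta>)\<^sup>2" "1 - m * (sin \<theta>)\<^sup>2 \<le> 1"
  "0 < 1 - m * (sin \<theta>)\<^sup>2"
proof -
  have s: "(sin \<theta>)\<^sup>2 \<le> 1" by (simp add: abs_square_le_1)
  show *: "1 - m \<le> 1 - m * (sin \<theta>)\<^sup>2" using mult_left_le[OF s, of m] m by simp
  show "1 - m * (sin \<theta>)\<^sup>2 \<le> 1" using m by simp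
  show "0 < 1 - m * (sin \<theta>)\<^sup>2" using * m by linarith
qed

lemma delta_ne: "1 - m * (sin \<theta>)\<^sup>2 \<noteq> 0" using delta_bounds(3)[of \<theta>] by simp

lemma DERIV_ellF: "((\<lambda>x. ellF x m) has_real_derivative 1 / sqrt (1 - m * (sin x)\<^sup>2)) (at x)"
  unfolding ellF_def
  by (rule DERIV_LBINT_from_0) (intro continuous_intros ballI, metis delta_ne real_sqrt_eq_zero_cancel_iff)

lemma DERIV_ellEinc: "(ellEinc m has_real_derivative sqrt (1 - m * (sin x)\<^sup>2)) (at x)"
  unfolding ellEinc_def
  by (rule DERIV_LBINT_from_0) (auto intro!: continuous_intros)

lemma ellF_deriv_ge_1: "1 \<le> 1 / sqrt (1 - m * (sin x)\<^sup>2)"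
  using delta_bounds[of x] by (simp add: pos_le_divide_eq)

lemma am_ellF: "am (ellF x m) m = x" and ellF_am: "ellF (am u m) m = u"
  and DERIV_am: "((\<lambda>u. am u m) has_real_derivative sqrt (1 - m * (sin (am u m))\<^sup>2)) (at u)"
  using real_expanding_diffeo[OF DERIV_ellF zero_less_one ellF_deriv_ge_1]
  unfolding am_def by auto

lemma ellF_0: "ellF 0 m = 0" by (simp add: ellF_def flip: zero_ereal_def)

lemma ellEinc_0: "ellEinc m 0 = 0" by (simp add: ellEinc_def flip: zero_ereal_def)

lemma ellF_minus: "ellF (- x) m = - ellF x m"
proof -
  have "((\<lambda>x. - ellF (- x) m) has_real_derivative 1 / sqrt (1 - m * (sin x)\<^sup>2)) (at x)" for x
    using DERIV_minus[OF DERIV_chain'[OF DERIV_minus[OF DERIV_ident] DERIV_ellF], of x] by simp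
  from eq_of_same_derivative[OF this DERIV_ellF, of 0 x] show ?thesis by (simp add: ellF_0)
qed

lemma ellEinc_minus: "ellEinc m (- x) = - ellEinc m x"
proof -
  have "((\<lambda>x. - ellEinc m (- x)) has_real_derivative sqrt (1 - m * (sin x)\<^sup>2)) (at x)" for x
    using DERIV_minus[OF DERIV_chain'[OF DERIV_minus[OF DERIV_ident] DERIV_ellEinc], of x] by simp
  from eq_of_same_derivative[OF this DERIV_ellEinc, of 0 x] show ?thesis by (simp add: ellEinc_0)
qed

lemma ellF_add_pi: "ellF (x + pi) m = ellF x m + 2 * ellK m"
proof -
  have "((\<lambda>x. ellF (x + pi) m - 2 * ellK m) has_real_derivative 1 / sqrt (1 - m * (sin x)\<^sup>2)) (at x)" for x
  proof -
    have "((\<lambda>x. x + pi) has_real_derivative 1) (at x)" by (auto intro!: derivative_eq_intros)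
    from DERIV_diff[OF DERIV_chain'[OF this DERIV_ellF] DERIV_const]
    show ?thesis by simp
  qed
  \<comment> \<open>At -pi/2 both sides are known: F(pi/2) - 2K = -K = F(-pi/2).\<close>
  from eq_of_same_derivative[OF this DERIV_ellF, of "-(pi/2)" x] ellF_minus[of "pi/2"]
  show ?thesis by (simp add: ellK_def)
qed

lemma am_K: "am (ellK m) m = pi / 2" and am_minus_K: "am (- ellK m) m = - (pi / 2)"
  using am_ellF[of "pi/2"] am_ellF[of "-(pi/2)"] ellF_minus[of "pi/2"] by (auto simp: ellK_def)

lemma am_add_2K: "am (u + 2 * ellK m) m = am u m + pi"
  using ellF_add_pi[of "am u m"] by (metis am_ellF ellF_am)

lemma cn_add_2K: "cn (u + 2 * ellK m) m = - cn u m"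
  by (simp add: cn_def am_add_2K)

lemma ellK_pos: "0 < ellK m"
proof -
  have "ellF 0 m < ellF (pi / 2) m"
  proof (rule DERIV_pos_imp_increasing[of 0 "pi / 2" "\<lambda>x. ellF x m"])
    show "\<exists>y. ((\<lambda>x. ellF x m) has_real_derivative y) (at x) \<and> 0 < y" for x
      using DERIV_ellF less_le_trans[OF zero_less_one ellF_deriv_ge_1] by blast
  qed (rule pi_half_gt_zero)
  then show ?thesis by (simp add: ellF_0 ellK_def)
qed

end

text \<open>\<open>(elasX m, elasY m)\<close> is a unit speed elastica with tangent \<open>(elasA m, elasB m)\<close> and
  curvature \<open>2 \<surd>m cn\<close>.\<close>

definition elasX :: "real \<Rightarrow> real \<Rightarrow> real" where
  "elasX m u = 2 * ellEinc m (am u m) - u"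

definition elasY :: "real \<Rightarrow> real \<Rightarrow> real" where
  "elasY m u = - 2 * sqrt m * cn u m"

definition elasA :: "real \<Rightarrow> real \<Rightarrow> real" where
  "elasA m u = 1 - 2 * m * (sin (am u m))\<^sup>2"

definition elasB :: "real \<Rightarrow> real \<Rightarrow> real" where
  "elasB m u = 2 * sqrt m * sin (am u m) * sqrt (1 - m * (sin (am u m))\<^sup>2)"

context
  fixes m :: real
  assumes m: "0 < m" "m < 1"
begin

lemma DERIV_elasX: "(elasX m has_real_derivative elasA m u) (at u)"
proof -
  have "((\<lambda>u. 2 * ellEinc m (am u m) - u) has_real_derivative
      2 * (sqrt (1 - m * (sin (am u m))\<^sup>2) * sqrt (1 - m * (sin (am u m))\<^sup>2)) - 1) (at u)"
    using DERIV_diff[OF DERIV_cmult[OF DERIV_chain'[OF DERIV_am[OF m] DERIV_ellEinc[OF m]], of 2] DERIV_ident]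
    by simp
  moreover have "2 * (sqrt (1 - m * (sin (am u m))\<^sup>2) * sqrt (1 - m * (sin (am u m))\<^sup>2)) - 1 = elasA m u"
    using delta_bounds(3)[OF m, of "am u m"] unfolding elasA_def by simp
  ultimately show ?thesis unfolding elasX_def[abs_def] by simp
qed

lemma DERIV_elasY: "(elasY m has_real_derivative elasB m u) (at u)"
  unfolding elasY_def[abs_def] elasB_def cn_def
  by (rule derivative_eq_intros DERIV_am m refl | simp)+

text \<open>One half of the planar Frenet system: (A, B) rotates with angular speed 2 sqrt(m) cn.
  The normal form later compares an arbitrary tangent with this solution.\<close>

lemma DERIV_elasA:
  "(elasA m has_real_derivative - (2 * sqrt m * cn u m) * elasB m u) (at u)"
  unfolding elasA_def[abs_def] elasB_def cn_def
  by (rule derivative_eq_intros DERIV_am m refl | simp add: m(1) less_imp_le)+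

lemma DERIV_elasB:
  "(elasB m has_real_derivative (2 * sqrt m * cn u m) * elasA m u) (at u)"
proof -
  define s where "s = sin (am u m)"
  define c where "c = cos (am u m)"
  define d where "d = sqrt (1 - m * s\<^sup>2)"
  have d: "0 < d" "d * d = 1 - m * s\<^sup>2"
    using delta_bounds(3)[OF m, of "am u m"] by (auto simp: d_def s_def)
  have ds: "((\<lambda>u. sin (am u m)) has_real_derivative c * d) (at u)"
    unfolding c_def d_def s_def by (rule derivative_eq_intros DERIV_am m refl | simp)+
  have "((\<lambda>u. 1 - m * (sin (am u m))\<^sup>2) has_real_derivative - (2 * m * s * (c * d))) (at u)"
    by (rule derivative_eq_intros ds refl | simp add: s_def)+
  from DERIV_chain'[OF this DERIV_real_sqrt] d(1)
  have dd: "((\<lambda>u. sqrt (1 - m * (sin (am u m))\<^sup>2)) has_real_derivative - (m * (s * (c * d))) / d) (at u)"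
    by (simp add: d_def s_def delta_bounds(3)[OF m] field_simps)
  have "(elasB m has_real_derivative 2 * sqrt m * (c * d * d - s * (m * (s * (c * d))) / d)) (at u)"
    unfolding elasB_def[abs_def]
    by (rule DERIV_cong[OF DERIV_mult[OF DERIV_cmult[OF ds] dd]])
       (use d(1) in \<open>simp add: field_simps flip: s_def d_def\<close>)
  \<comment> \<open>The quotient by d cancels; since d^2 = 1 - m s^2, the last factor is 1 - 2 m
    s^2, that is \<open>elasA\<close>.\<close>
  also have "2 * sqrt m * (c * d * d - s * (m * (s * (c * d))) / d) = (2 * sqrt m * c) * (d * d - m * s\<^sup>2)"
    using d(1) by (simp add: field_simps power2_eq_square)
  also have "\<dots> = (2 * sqrt m * cn u m) * elasA m u"
    by (simp add: d(2) elasA_def s_def cn_def c_def)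
  finally show ?thesis .
qed

lemma elasAB_unit: "(elasA m u)\<^sup>2 + (elasB m u)\<^sup>2 = 1"
proof -
  define s where "s = sin (am u m)"
  have "(elasB m u)\<^sup>2 = 4 * m * s\<^sup>2 * (1 - m * s\<^sup>2)"
    using delta_bounds(3)[OF m, of "am u m"] m
    by (simp add: elasB_def power_mult_distrib s_def less_imp_le)
  then show ?thesis by (simp add: elasA_def flip: s_def) (simp add: power2_eq_square algebra_simps)
qed

lemma elasA_pm_K: "elasA m (ellK m) = 1 - 2 * m" "elasA m (- ellK m) = 1 - 2 * m"
  and elasB_pm_K: "elasB m (ellK m) = 2 * sqrt m * sqrt (1 - m)"
    "elasB m (- ellK m) = - (2 * sqrt m * sqrt (1 - m))"
  and elasY_pm_K: "elasY m (ellK m) = 0" "elasY m (- ellK m) = 0"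
  by (auto simp: elasA_def elasB_def elasY_def cn_def am_K[OF m] am_minus_K[OF m])

text \<open>The amplitude grows by pi, so sin and cos both change sign: what is even in them is
  kept, while the height \<open>elasY\<close> flips.\<close>

lemma elasA_add_2K: "elasA m (u + 2 * ellK m) = elasA m u"
  and elasY_add_2K: "elasY m (u + 2 * ellK m) = - elasY m u"
  by (auto simp: elasA_def elasY_def cn_def am_add_2K[OF m])

end

section \<open>The parameter of the figure-eight\<close>

lemma delta_pos: "0 < 1 - m * (sin \<theta>)\<^sup>2" if "0 \<le> m" "m < 1" for m \<theta> :: real
  using that delta_bounds(3)[of m \<theta>] by (cases "m = 0") auto

text \<open>The integrand of K - 2E. Treating the difference as one integral turns its monotonicity,
  its continuity and its sign at m = 1/2 into statements about the integrand.\<close>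

definition ellG :: "real \<Rightarrow> real \<Rightarrow> real" where
  "ellG m \<theta> = 1 / sqrt (1 - m * (sin \<theta>)\<^sup>2) - 2 * sqrt (1 - m * (sin \<theta>)\<^sup>2)"

lemma continuous_on_ellK_integrand:
  assumes "0 \<le> m" "m < 1" shows "continuous_on S (\<lambda>\<theta>. 1 / sqrt (1 - m * (sin \<theta>)\<^sup>2))"
  by (intro continuous_intros ballI) (metis delta_pos[OF assms] less_irrefl real_sqrt_eq_zero_cancel_iff)

lemma ellK_integral: "0 \<le> m \<Longrightarrow> m < 1 \<Longrightarrow> ellK m = integral {0..pi/2} (\<lambda>\<theta>. 1 / sqrt (1 - m * (sin \<theta>)\<^sup>2))"
  unfolding ellK_def ellF_def zero_ereal_def
  by (intro interval_integral_eq_integral borel_integrable_atLeastAtMost' continuous_on_ellK_integrand) auto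

lemma ellE_integral: "ellE m = integral {0..pi/2} (\<lambda>\<theta>. sqrt (1 - m * (sin \<theta>)\<^sup>2))"
  unfolding ellE_def zero_ereal_def
  by (intro interval_integral_eq_integral borel_integrable_atLeastAtMost' continuous_intros) auto

lemma ellK_minus_2ellE:
  assumes "0 \<le> m" "m < 1" shows "ellK m - 2 * ellE m = integral {0..pi/2} (ellG m)"
proof -
  have "integral {0..pi/2} (ellG m) = integral {0..pi/2} (\<lambda>\<theta>. 1 / sqrt (1 - m * (sin \<theta>)\<^sup>2))
     - integral {0..pi/2} (\<lambda>\<theta>. 2 * sqrt (1 - m * (sin \<theta>)\<^sup>2))"
    unfolding ellG_def[abs_def]
    by (intro Henstock_Kurzweil_Integration.integral_diff integrable_continuous_real
        continuous_on_ellK_integrand assms continuous_intros)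
  then show ?thesis by (simp add: ellK_integral assms ellE_integral)
qed

lemma continuous_on_ellG: "0 \<le> m \<Longrightarrow> m < 1 \<Longrightarrow> continuous_on S (ellG m)"
  unfolding ellG_def[abs_def] by (intro continuous_intros continuous_on_ellK_integrand)

text \<open>A larger m shrinks the square root wherever sin x > 0, which raises its reciprocal and
  lowers the subtracted term.\<close>

lemma ellK_minus_2ellE_strict_mono:
  assumes "0 \<le> m" "m < m'" "m' < 1"
  shows "ellK m - 2 * ellE m < ellK m' - 2 * ellE m'"
proof -
  have "integral {0..pi/2} (ellG m) < integral {0..pi/2} (ellG m')"
  proof (rule integral_less_real)
    fix x :: real assume x: "x \<in> {0<..<pi/2}"
    then have "0 < sin x" by (auto intro: sin_gt_zero)
    then have "1 - m' * (sin x)\<^sup>2 < 1 - m * (sin x)\<^sup>2" using assms by simp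
    then have *: "sqrt (1 - m' * (sin x)\<^sup>2) < sqrt (1 - m * (sin x)\<^sup>2)" by simp
    moreover have "0 < sqrt (1 - m' * (sin x)\<^sup>2)" using delta_pos[of m' x] assms by simp
    ultimately have "1 / sqrt (1 - m * (sin x)\<^sup>2) < 1 / sqrt (1 - m' * (sin x)\<^sup>2)"
      by (intro divide_strict_left_mono) auto
    with * show "ellG m x < ellG m' x" unfolding ellG_def by linarith
  qed (use assms in \<open>auto intro: continuous_on_ellG simp: not_le\<close>)
  then show ?thesis using assms by (simp add: ellK_minus_2ellE)
qed

lemma continuous_on_ellK_minus_2ellE:
  assumes "0 \<le> a" "b < 1" shows "continuous_on {a..b} (\<lambda>m. ellK m - 2 * ellE m)"
proof -
  have "continuous_on {a..b} (\<lambda>m. integral (cbox 0 (pi/2)) (ellG m))"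
  proof (rule integral_continuous_on_param)
    show "continuous_on ({a..b} \<times> cbox 0 (pi/2)) (\<lambda>(m, \<theta>). ellG m \<theta>)"
      unfolding ellG_def split_beta
    proof (intro continuous_intros ballI)
      fix z assume "z \<in> {a..b} \<times> cbox 0 (pi/2)"
      then have "0 < 1 - fst z * (sin (snd z))\<^sup>2" using assms by (intro delta_pos) auto
      then show "sqrt (1 - fst z * (sin (snd z))\<^sup>2) \<noteq> 0" by simp
    qed
  qed
  then show ?thesis
    by (rule continuous_on_eq) (use assms in \<open>auto simp: ellK_minus_2ellE\<close>)
qed

text \<open>With d the square root, 1/d < 2d means d^2 > 1/2, and for m = 1/2 this holds wherever
  sin^2 x < 1. The resulting strict bound mstar > 1/2 carries both arguments about end
  tangents.\<close>

lemma ellK_less_2ellE_half: "ellK (1/2) < 2 * ellE (1/2)"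
proof -
  have "integral {0..pi/2} (ellG (1/2)) < integral {0..pi/2} (\<lambda>_. 0)"
  proof (rule integral_less_real)
    fix x :: real assume x: "x \<in> {0<..<pi/2}"
    then have "0 < cos x" by (auto intro: cos_gt_zero)
    then have "(sin x)\<^sup>2 < 1" by (simp add: sin_squared_eq)
    then have d: "1 / 2 < 1 - 1 / 2 * (sin x)\<^sup>2" by simp
    then have "sqrt (1 - 1 / 2 * (sin x)\<^sup>2) * sqrt (1 - 1 / 2 * (sin x)\<^sup>2) = 1 - 1 / 2 * (sin x)\<^sup>2"
      by simp
    moreover have "0 < sqrt (1 - 1 / 2 * (sin x)\<^sup>2)" using d by simp
    ultimately show "ellG (1/2) x < 0"
      using d unfolding ellG_def by (simp only: diff_less_0_iff_less pos_divide_less_eq mult.assoc)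
  qed (auto intro: continuous_on_ellG simp: not_le)
  then show ?thesis using ellK_minus_2ellE[of "1/2"] by simp
qed

lemma ellE_le: "0 \<le> m \<Longrightarrow> m < 1 \<Longrightarrow> ellE m \<le> pi / 2"
proof -
  assume m: "0 \<le> m" "m < 1"
  have "ellE m \<le> integral {0..pi/2} (\<lambda>_. 1)"
    unfolding ellE_integral using m
    by (intro integral_le integrable_continuous_real continuous_intros) auto
  then show ?thesis by simp
qed

text \<open>The integrand of \<open>K(1 - \<delta>\<^sup>2)\<close> is at least \<open>1 / (\<delta> + \<pi>/2 - \<theta>)\<close>.\<close>

lemma ellK_lower_bound:
  assumes "0 < \<delta>" "\<delta> < 1" shows "ln (1 / \<delta>) \<le> ellK (1 - \<delta>\<^sup>2)"
proof -
  define c where "c = \<delta> + pi/2"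
  have d2: "\<delta>\<^sup>2 < 1" using assms by (simp add: power_less_one_iff)
  have I: "((\<lambda>\<theta>. 1 / (c - \<theta>)) has_integral (- ln (c - pi/2)) - (- ln (c - 0))) {0..pi/2}"
  proof (rule fundamental_theorem_of_calculus)
    fix x assume x: "x \<in> {0..pi/2}"
    have "((\<lambda>x. - ln (c - x)) has_real_derivative 1 / (c - x)) (at x)"
      using x assms by (auto intro!: derivative_eq_intros simp: c_def)
    then show "((\<lambda>x. - ln (c - x)) has_vector_derivative 1 / (c - x)) (at x within {0..pi/2})"
      by (simp add: has_real_derivative_iff_has_vector_derivative has_vector_derivative_at_within)
  qed simp
  have K: "((\<lambda>\<theta>. 1 / sqrt (1 - (1 - \<delta>\<^sup>2) * (sin \<theta>)\<^sup>2)) has_integral ellK (1 - \<delta>\<^sup>2)) {0..pi/2}"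
    using assms d2 by (subst ellK_integral)
      (auto intro!: integrable_integral integrable_continuous_real continuous_on_ellK_integrand)
  have "- ln \<delta> + ln c \<le> ellK (1 - \<delta>\<^sup>2)"
  proof (rule has_integral_le[OF _ K])
    show "((\<lambda>\<theta>. 1 / (c - \<theta>)) has_integral - ln \<delta> + ln c) {0..pi/2}"
      using I by (simp add: c_def)
    fix x assume x: "x \<in> {0..pi/2}"
    \<comment> \<open>The radicand is \<delta>^2 + (1 - \<delta>^2) cos^2 x, and cos x = sin(pi/2 -
      x) \<le> pi/2 - x, so it is at most \<delta>^2 + (pi/2 - x)^2 and hence at most (c -
      x)^2.\<close>
    have "0 \<le> cos x" using x by (intro cos_ge_zero) auto
    moreover have "cos x \<le> pi/2 - x"
      using sin_x_le_x[of "pi/2 - x"] x by (simp add: sin_diff)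
    ultimately have "(cos x)\<^sup>2 \<le> (pi/2 - x)\<^sup>2" by (simp add: power_mono)
    moreover have "1 - (1 - \<delta>\<^sup>2) * (sin x)\<^sup>2 = \<delta>\<^sup>2 + (1 - \<delta>\<^sup>2) * (cos x)\<^sup>2"
      by (simp add: sin_squared_eq algebra_simps)
    moreover have "(1 - \<delta>\<^sup>2) * (cos x)\<^sup>2 \<le> (cos x)\<^sup>2" by (simp add: mult_le_cancel_right1 mult_left_le_one_le d2 less_imp_le)
    moreover have "0 \<le> \<delta> * (pi/2 - x)" using x assms by simp
    moreover have "(c - x)\<^sup>2 = \<delta>\<^sup>2 + 2 * (\<delta> * (pi/2 - x)) + (pi/2 - x)\<^sup>2"
      by (simp add: c_def power2_eq_square algebra_simps)
    ultimately have "1 - (1 - \<delta>\<^sup>2) * (sin x)\<^sup>2 \<le> (c - x)\<^sup>2" by linarith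
    moreover have "0 < c - x" using x assms by (simp add: c_def)
    ultimately have "sqrt (1 - (1 - \<delta>\<^sup>2) * (sin x)\<^sup>2) \<le> c - x"
      by (simp add: real_le_lsqrt less_imp_le)
    moreover have "0 < sqrt (1 - (1 - \<delta>\<^sup>2) * (sin x)\<^sup>2)" using delta_pos[of "1 - \<delta>\<^sup>2" x] d2 assms by simp
    ultimately show "1 / (c - x) \<le> 1 / sqrt (1 - (1 - \<delta>\<^sup>2) * (sin x)\<^sup>2)"
      using \<open>0 < c - x\<close> by (intro divide_left_mono mult_pos_pos) auto
  qed
  moreover have "0 \<le> ln c" using assms pi_ge_two by (simp add: c_def)
  ultimately show ?thesis using assms by (simp add: ln_div)
qed

text \<open>K - 2E is negative at 1/2 and nonnegative at a parameter close to 1, so it vanishes in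
  between; strict monotonicity makes the zero unique in (0, 1), as the description operator
  requires.\<close>

lemma mstar_gt_half: "1 / 2 < mstar"
  and mstar_less_1: "mstar < 1"
  and ellK_mstar: "ellK mstar = 2 * ellE mstar"
proof -
  \<comment> \<open>Chosen so that ln(1/\<delta>) = pi: then K(m1) \<ge> pi, while 2E(m1) \<le>
    pi.\<close>
  define \<delta> where "\<delta> = exp (- pi)"
  define m1 where "m1 = 1 - \<delta>\<^sup>2"
  have "exp (-pi) \<le> 1/2"
  proof -
    have "2 \<le> exp pi" using exp_ge_add_one_self[of pi] pi_ge_two by linarith
    then show ?thesis by (simp add: exp_minus field_simps)
  qed
  then have \<delta>: "0 < \<delta>" "\<delta> \<le> 1/2" by (auto simp: \<delta>_def)
  have "\<delta>\<^sup>2 \<le> (1/2)\<^sup>2" using \<delta> by (intro power_mono) auto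
  then have m1: "1/2 \<le> m1" "m1 < 1" using \<delta> by (auto simp: m1_def power2_eq_square)
  have "pi \<le> ellK m1" using ellK_lower_bound[of \<delta>] \<delta> by (simp add: m1_def) (simp add: \<delta>_def ln_div)
  moreover have "ellE m1 \<le> pi/2" using m1 by (intro ellE_le) auto
  ultimately have "0 \<le> ellK m1 - 2 * ellE m1" by simp
  moreover have "ellK (1/2) - 2 * ellE (1/2) \<le> 0" using ellK_less_2ellE_half by simp
  ultimately have "\<exists>m\<ge>1/2. m \<le> m1 \<and> ellK m - 2 * ellE m = 0"
    using m1 by (intro IVT' continuous_on_ellK_minus_2ellE) auto
  then obtain m where m: "1/2 \<le> m" "m \<le> m1" "ellK m = 2 * ellE m" by auto
  have m2: "1/2 < m" using m ellK_less_2ellE_half by (cases "m = 1/2") auto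
  have uniq: "n = m" if "0 < n \<and> n < 1 \<and> ellK n = 2 * ellE n" for n
    using ellK_minus_2ellE_strict_mono[of n m] ellK_minus_2ellE_strict_mono[of m n] that m m1 m2
    by (cases n m rule: linorder_cases) auto
  have "mstar = m" unfolding mstar_def using m m1 m2 uniq by (intro the_equality) auto
  then show "1 / 2 < mstar" "mstar < 1" "ellK mstar = 2 * ellE mstar" using m m1 m2 by auto
qed

lemma mstar_bounds: "0 < mstar" "mstar < 1"
  using mstar_gt_half mstar_less_1 by auto

lemma elasX_pm_K: "elasX mstar (ellK mstar) = 0" "elasX mstar (- ellK mstar) = 0"
proof -
  have "ellEinc mstar (pi/2) = ellK mstar / 2" using ellK_mstar by (simp add: ellE_eq_ellEinc)
  then show "elasX mstar (ellK mstar) = 0" "elasX mstar (- ellK mstar) = 0"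
    using ellEinc_minus[OF mstar_bounds, of "pi/2"]
    by (simp_all add: elasX_def am_K[OF mstar_bounds] am_minus_K[OF mstar_bounds])
qed

text \<open>\<open>elasA\<close> has period 2K for every parameter, so \<open>elasX\<close> is
  periodic as soon as its gain over one period vanishes; this is where K = 2E enters.\<close>

lemma elasX_add_2K: "elasX mstar (u + 2 * ellK mstar) = elasX mstar u"
proof -
  have "((\<lambda>u. elasX mstar (u + 2 * ellK mstar)) has_real_derivative elasA mstar u) (at u)" for u
  proof -
    have "((\<lambda>u. u + 2 * ellK mstar) has_real_derivative 1) (at u)" by (auto intro!: derivative_eq_intros)
    from DERIV_chain'[OF this DERIV_elasX[OF mstar_bounds]]
    show ?thesis by (simp add: elasA_add_2K[OF mstar_bounds])
  qed
  from eq_of_same_derivative[OF this DERIV_elasX[OF mstar_bounds], of "- ellK mstar"]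
  show ?thesis by (simp add: elasX_pm_K)
qed

section \<open>Sobolev curves\<close>

lemma set_integral_shift:
  fixes f :: "real \<Rightarrow> 'a::{banach, second_countable_topology}"
  shows "(LINT t:{a + c..b + c}|lborel. f t) = (LINT t:{a..b}|lborel. f (t + c))"
proof -
  have "indicator {a + c..b + c} (c + x) = (indicator {a..b} x :: real)" for x
    by (auto simp: indicator_def)
  then show ?thesis
    unfolding set_lebesgue_integral_def
    by (subst lborel_integral_real_affine[of 1 _ c]) (simp_all add: add.commute)
qed

lemma L2_on_shift:
  assumes "L2_on (a + c) (b + c) u" shows "L2_on a b (\<lambda>t. u (t + c))"
proof -
  have ind: "indicator {a + c..b + c} (x + c) = (indicator {a..b} x :: real)" for x
    by (auto simp: indicator_def)
  have "(\<lambda>x. indicator {a + c..b + c} x *\<^sub>R u x) \<in> borel_measurable borel"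
    using assms by (simp add: L2_on_def set_borel_measurable_def)
  from measurable_compose[OF borel_measurable_add[OF borel_measurable_const measurable_ident_sets[OF refl]] this, of c]
  have "(\<lambda>x. indicator {a..b} x *\<^sub>R u (x + c)) \<in> borel_measurable borel"
    by (simp add: ind add.commute[of c])
  moreover have "integrable lborel (\<lambda>x. (\<lambda>x. indicator {a + c..b + c} x *\<^sub>R (norm (u x))\<^sup>2) (c + 1 * x))"
    using assms by (subst lborel_integrable_real_affine_iff) (simp_all add: L2_on_def set_integrable_def)
  ultimately show ?thesis
    by (simp add: L2_on_def set_borel_measurable_def set_integrable_def ind add.commute[of c])
qed

lemma C1c_on_shift:
  assumes "C1c_on a b \<phi> \<phi>'" shows "C1c_on (a + c) (b + c) (\<lambda>t. \<phi> (t - c)) (\<lambda>t. \<phi>' (t - c))"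
proof -
  from assms obtain p q where pq: "a < p" "p < q" "q < b" "\<And>t. t \<notin> {p..q} \<Longrightarrow> \<phi> t = 0"
    and D: "\<And>t. (\<phi> has_real_derivative \<phi>' t) (at t)" and cont: "continuous_on UNIV \<phi>'"
    unfolding C1c_on_def by auto
  have "((\<lambda>t. \<phi> (t - c)) has_real_derivative \<phi>' (t - c)) (at t)" for t
  proof -
    have "((\<lambda>t. t - c) has_real_derivative 1) (at t)" by (auto intro!: derivative_eq_intros)
    from DERIV_chain'[OF this D] show ?thesis by simp
  qed
  moreover have "continuous_on UNIV (\<lambda>t. \<phi>' (t - c))"
    by (intro continuous_intros continuous_on_compose2[OF cont]) auto
  moreover have "\<phi> (t - c) = 0" if "t \<notin> {p + c..q + c}" for t
    using that by (intro pq) auto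
  moreover have "a + c < p + c" "p + c < q + c" "q + c < b + c" using pq(1-3) by simp_all
  ultimately show ?thesis unfolding C1c_on_def by blast
qed

lemma weak_deriv_on_shift:
  assumes "weak_deriv_on (a + c) (b + c) u g"
  shows "weak_deriv_on a b (\<lambda>t. u (t + c)) (\<lambda>t. g (t + c))"
  unfolding weak_deriv_on_def
proof (intro allI impI)
  fix \<phi> \<phi>' assume "C1c_on a b \<phi> \<phi>'"
  from assms[unfolded weak_deriv_on_def, rule_format, OF C1c_on_shift[OF this]]
  show "(LINT t:{a..b}|lborel. \<phi>' t *\<^sub>R u (t + c)) = - (LINT t:{a..b}|lborel. \<phi> t *\<^sub>R g (t + c))"
    by (simp add: set_integral_shift)
qed

lemma H2_on_shift:
  assumes "H2_on (a + c) (b + c) \<gamma>" shows "H2_on a b (\<lambda>t. \<gamma> (t + c))"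
proof -
  obtain g h where cont: "continuous_on {a + c..b + c} \<gamma>"
    and gh: "L2_on (a + c) (b + c) \<gamma>" "L2_on (a + c) (b + c) g"
      "L2_on (a + c) (b + c) h" "weak_deriv_on (a + c) (b + c) \<gamma> g" "weak_deriv_on (a + c) (b + c) g h"
    using assms unfolding H2_on_def by blast
  have "continuous_on {a..b} (\<lambda>t. t + c)" by (intro continuous_intros)
  then have "continuous_on {a..b} (\<lambda>t. \<gamma> (t + c))"
    by (rule continuous_on_compose2[OF cont]) auto
  then show ?thesis unfolding H2_on_def
    using L2_on_shift[OF gh(1)] L2_on_shift[OF gh(2)] L2_on_shift[OF gh(3)]
      weak_deriv_on_shift[OF gh(4)] weak_deriv_on_shift[OF gh(5)] by blast
qed

section \<open>Classically differentiable functions as Sobolev functions\<close>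

lemma L2_on_continuous:
  fixes u :: "real \<Rightarrow> 'a::euclidean_space"
  assumes "continuous_on {a..b} u" shows "L2_on a b u"
proof -
  have "set_integrable lborel {a..b} u" by (rule borel_integrable_atLeastAtMost'[OF assms])
  moreover have "set_integrable lborel {a..b} (\<lambda>t. (norm (u t))\<^sup>2)"
    by (intro borel_integrable_atLeastAtMost' continuous_intros assms)
  ultimately show ?thesis
    unfolding L2_on_def set_borel_measurable_def set_integrable_def
    using borel_measurable_integrable by blast
qed

text \<open>Integration by parts: the derivative of \<phi> u integrates to boundary terms, which
  vanish because \<phi> is zero at a and b.\<close>

lemma weak_deriv_on_classical:
  fixes u :: "real \<Rightarrow> 'a::euclidean_space"
  assumes u: "\<And>t. (u has_vector_derivative g t) (at t)" and g: "continuous_on UNIV g"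
  shows "weak_deriv_on a b u g"
  unfolding weak_deriv_on_def
proof (intro allI impI)
  fix \<phi> \<phi>' assume "C1c_on a b \<phi> \<phi>'"
  then obtain p q where pq: "a < p" "p < q" "q < b" "\<And>t. t \<notin> {p..q} \<Longrightarrow> \<phi> t = 0"
    and D: "\<And>t. (\<phi> has_real_derivative \<phi>' t) (at t)" and cont: "continuous_on UNIV \<phi>'"
    unfolding C1c_on_def by auto
  have cu: "continuous_on UNIV u"
    by (auto intro!: continuous_at_imp_continuous_on has_vector_derivative_continuous[OF u])
  have cphi: "continuous_on UNIV \<phi>"
    by (auto intro!: continuous_at_imp_continuous_on DERIV_isCont[OF D])
  note c = cu[THEN continuous_on_subset, OF subset_UNIV] cphi[THEN continuous_on_subset, OF subset_UNIV]
    g[THEN continuous_on_subset, OF subset_UNIV] cont[THEN continuous_on_subset, OF subset_UNIV]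
  have i1: "set_integrable lborel {a..b} (\<lambda>t. \<phi>' t *\<^sub>R u t)"
    by (intro borel_integrable_atLeastAtMost' continuous_intros c)
  have i2: "set_integrable lborel {a..b} (\<lambda>t. \<phi> t *\<^sub>R g t)"
    by (intro borel_integrable_atLeastAtMost' continuous_intros c)
  have "(LINT t:{a..b}|lborel. \<phi> t *\<^sub>R g t + \<phi>' t *\<^sub>R u t) = \<phi> b *\<^sub>R u b - \<phi> a *\<^sub>R u a"
    unfolding set_lebesgue_integral_def
  proof (rule integral_FTC_atLeastAtMost)
    show "a \<le> b" using pq by simp
    show "continuous_on {a..b} (\<lambda>t. \<phi> t *\<^sub>R g t + \<phi>' t *\<^sub>R u t)"
      by (intro continuous_intros c)
    fix t
    show "((\<lambda>t. \<phi> t *\<^sub>R u t) has_vector_derivative \<phi> t *\<^sub>R g t + \<phi>' t *\<^sub>R u t) (at t within {a..b})"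
      by (rule has_vector_derivative_at_within[OF has_vector_derivative_scaleR[OF D u]])
  qed
  also have "\<dots> = 0" using pq by simp
  finally show "(LINT t:{a..b}|lborel. \<phi>' t *\<^sub>R u t) = - (LINT t:{a..b}|lborel. \<phi> t *\<^sub>R g t)"
    using set_integral_add(2)[OF i2 i1] by (simp add: eq_neg_iff_add_eq_0 add.commute)
qed

text \<open>Supplies the Sobolev regularity of the explicit figure-eight, whose second derivative is
  continuous.\<close>

lemma H2_on_classical:
  fixes u :: "real \<Rightarrow> 'a::euclidean_space"
  assumes u: "\<And>t. (u has_vector_derivative g t) (at t)"
    and g: "\<And>t. (g has_vector_derivative h t) (at t)" and h: "continuous_on UNIV h"
  shows "H2_on a b u"
proof -
  have cu: "continuous_on UNIV u" and cg: "continuous_on UNIV g"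
    by (auto intro!: continuous_at_imp_continuous_on has_vector_derivative_continuous[OF u]
        has_vector_derivative_continuous[OF g])
  note c = cu[THEN continuous_on_subset, OF subset_UNIV] cg[THEN continuous_on_subset, OF subset_UNIV]
    h[THEN continuous_on_subset, OF subset_UNIV]
  show ?thesis unfolding H2_on_def
    by (intro conjI exI[of _ g] exI[of _ h] weak_deriv_on_classical u cg g h L2_on_continuous c)
qed

section \<open>Test functions and the absence of corners\<close>

text \<open>The third power makes this function twice continuously differentiable; both the bump and
  its derivative will serve as C^1 test functions.\<close>

definition bump :: "real \<Rightarrow> real" where "bump x = (max 0 (1 - x\<^sup>2)) ^ 3"
definition bump' :: "real \<Rightarrow> real" where "bump' x = - 6 * x * (max 0 (1 - x\<^sup>2))\<^sup>2"
definition bump'' :: "real \<Rightarrow> real" where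
  "bump'' x = 24 * x\<^sup>2 * max 0 (1 - x\<^sup>2) - 6 * (max 0 (1 - x\<^sup>2))\<^sup>2"

lemma DERIV_max_0_power2: "((\<lambda>y::real. (max 0 y)\<^sup>2) has_real_derivative 2 * max 0 y) (at y)"
proof (cases y "0 :: real" rule: linorder_cases)
  case less
  have "((\<lambda>y::real. 0) has_real_derivative 2 * max 0 y) (at y)" using less by simp
  then show ?thesis
    by (rule has_field_derivative_transform_within_open[of _ _ _ "{..<0}"]) (use less in auto)
next
  case greater
  have "((\<lambda>y::real. y\<^sup>2) has_real_derivative 2 * max 0 y) (at y)"
    using greater by (auto intro!: derivative_eq_intros)
  then show ?thesis
    by (rule has_field_derivative_transform_within_open[of _ _ _ "{0<..}"]) (use greater in auto)
next
  case equal
  have "((\<lambda>h::real. (max 0 h)\<^sup>2 / h) \<longlongrightarrow> 0) (at 0)"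
  proof (rule Lim_null_comparison)
    show "\<forall>\<^sub>F x in at 0. norm ((max 0 x)\<^sup>2 / x) \<le> \<bar>x::real\<bar>"
      by (rule always_eventually) (auto simp: max_def power2_eq_square)
    show "((\<lambda>x::real. \<bar>x\<bar>) \<longlongrightarrow> 0) (at 0)" by (intro tendsto_eq_intros) auto
  qed
  then show ?thesis using equal by (simp add: has_field_derivative_iff)
qed

lemma DERIV_max_0_power3: "((\<lambda>y::real. (max 0 y) ^ 3) has_real_derivative 3 * (max 0 y)\<^sup>2) (at y)"
proof -
  have "(\<lambda>y::real. (max 0 y) ^ 3) = (\<lambda>y. y * (max 0 y)\<^sup>2)"
    by (auto simp: max_def power3_eq_cube power2_eq_square)
  moreover have "((\<lambda>y::real. y * (max 0 y)\<^sup>2) has_real_derivative 3 * (max 0 y)\<^sup>2) (at y)"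
    by (rule derivative_eq_intros DERIV_max_0_power2 refl)+ (auto simp: max_def power2_eq_square)
  ultimately show ?thesis by simp
qed

lemma DERIV_one_minus_square: "((\<lambda>x::real. 1 - x\<^sup>2) has_real_derivative - 2 * x) (at x)"
  by (auto intro!: derivative_eq_intros)

lemma DERIV_bump: "(bump has_real_derivative bump' x) (at x)"
  using DERIV_chain'[OF DERIV_one_minus_square DERIV_max_0_power3]
  unfolding bump_def[abs_def] bump'_def by (simp add: algebra_simps)

lemma DERIV_bump': "(bump' has_real_derivative bump'' x) (at x)"
proof -
  have "((\<lambda>x. - 6 * x) has_real_derivative - 6) (at x)" by (auto intro!: derivative_eq_intros)
  from DERIV_mult[OF this DERIV_chain'[OF DERIV_one_minus_square DERIV_max_0_power2]]
  show ?thesis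
    unfolding bump'_def[abs_def] bump''_def
    by (rule DERIV_cong) (simp add: algebra_simps power2_eq_square)
qed

lemma continuous_on_bump': "continuous_on S bump'" and continuous_on_bump'': "continuous_on S bump''"
  unfolding bump'_def[abs_def] bump''_def[abs_def] by (intro continuous_intros)+

lemma bump_outside: "1 \<le> \<bar>x\<bar> \<Longrightarrow> bump x = 0" "1 \<le> \<bar>x\<bar> \<Longrightarrow> bump' x = 0" "1 \<le> \<bar>x\<bar> \<Longrightarrow> bump'' x = 0"
proof -
  assume "1 \<le> \<bar>x\<bar>"
  then have "1 \<le> x\<^sup>2" using power_mono[of 1 "\<bar>x\<bar>" 2] by simp
  then show "bump x = 0" "bump' x = 0" "bump'' x = 0"
    by (auto simp: bump_def bump'_def bump''_def)
qed

lemma bump_bounds: "0 \<le> bump x" "bump x \<le> 1" "\<bar>bump'' x\<bar> \<le> 24"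
proof -
  define M where "M = max 0 (1 - x\<^sup>2)"
  have M: "0 \<le> M" "M \<le> 1" by (auto simp: M_def)
  show "0 \<le> bump x" "bump x \<le> 1" using M by (auto simp: bump_def power_le_one simp flip: M_def)
  \<comment> \<open>Both x^2 M and M^2 lie in [0, 1], so the second derivative lies in
    [-6, 24].\<close>
  have "0 \<le> x\<^sup>2 * M" using M by simp
  moreover have "x\<^sup>2 * M \<le> 1"
  proof (cases "x\<^sup>2 \<le> 1")
    case True then show ?thesis using M by (simp add: mult_le_one)
  qed (simp add: M_def)
  moreover have "0 \<le> M\<^sup>2" "M\<^sup>2 \<le> 1" using M by (auto simp: power_le_one)
  ultimately show "\<bar>bump'' x\<bar> \<le> 24" unfolding bump''_def M_def[symmetric] mult.assoc by (simp only: abs_le_iff) linarith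
qed

lemma bump_0: "bump 0 = 1" "bump' 0 = 0" by (auto simp: bump_def bump'_def)

text \<open>The factor c keeps the shape of the statement under repetition: each differentiation
  replaces it by c / e.\<close>

lemma DERIV_scaled:
  assumes "\<And>x. (f has_real_derivative f' x) (at x)"
  shows "((\<lambda>t. f ((t - t0) / e) * c) has_real_derivative f' ((t - t0) / e) * (c / e)) (at t)"
proof -
  have "((\<lambda>t. (t - t0) / e) has_real_derivative 1 / e) (at t)"
    by (auto intro!: derivative_eq_intros DERIV_cdivide)
  from DERIV_cmult_right[OF DERIV_chain'[OF this assms]] show ?thesis by simp
qed

lemma scaled_bump_outside:
  assumes "0 < e" "t \<notin> {t0 - e<..<t0 + e}"
  shows "bump ((t - t0) / e) = 0" "bump' ((t - t0) / e) = 0" "bump'' ((t - t0) / e) = 0"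
proof -
  have "e \<le> \<bar>t - t0\<bar>" using assms by auto
  then have "1 \<le> \<bar>(t - t0) / e\<bar>" using assms by simp
  then show "bump ((t - t0) / e) = 0" "bump' ((t - t0) / e) = 0" "bump'' ((t - t0) / e) = 0"
    by (rule bump_outside)+
qed

lemma C1c_on_scaled_bump:
  assumes "0 < e" "a < t0 - e" "t0 + e < b"
  shows "C1c_on a b (\<lambda>t. bump ((t - t0) / e)) (\<lambda>t. bump' ((t - t0) / e) * (1 / e))"
    and "C1c_on a b (\<lambda>t. bump' ((t - t0) / e) * (1 / e)) (\<lambda>t. bump'' ((t - t0) / e) * (1 / e / e))"
proof -
  have 1: "a < t0 - e \<and> t0 - e < t0 + e \<and> t0 + e < b" using assms by auto
  have z: "\<forall>t. t \<notin> {t0 - e..t0 + e} \<longrightarrow> bump ((t - t0) / e) = 0"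
    "\<forall>t. t \<notin> {t0 - e..t0 + e} \<longrightarrow> bump' ((t - t0) / e) * (1 / e) = 0"
    using scaled_bump_outside[OF assms(1)] by auto
  have d: "\<forall>t. ((\<lambda>t. bump ((t - t0) / e)) has_real_derivative bump' ((t - t0) / e) * (1 / e)) (at t)"
    using DERIV_scaled[OF DERIV_bump, of t0 e 1] by simp
  have c: "continuous_on UNIV (\<lambda>t. (t - t0) / e)" using assms by (intro continuous_intros) auto
  have "continuous_on UNIV (\<lambda>t. bump' ((t - t0) / e) * (1 / e))"
    by (intro continuous_on_mult_right continuous_on_compose2[OF continuous_on_bump' c]) auto
  then show "C1c_on a b (\<lambda>t. bump ((t - t0) / e)) (\<lambda>t. bump' ((t - t0) / e) * (1 / e))"
    unfolding C1c_on_def using d 1 z(1) by blast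
  have "continuous_on UNIV (\<lambda>t. bump'' ((t - t0) / e) * (1 / e / e))"
    by (intro continuous_on_mult_right continuous_on_compose2[OF continuous_on_bump'' c]) auto
  then show "C1c_on a b (\<lambda>t. bump' ((t - t0) / e) * (1 / e)) (\<lambda>t. bump'' ((t - t0) / e) * (1 / e / e))"
    unfolding C1c_on_def using DERIV_scaled[OF DERIV_bump', of t0 e "1 / e"] 1 z(2) by blast
qed

text \<open>Testing a corner with slopes \<open>w\<close> and \<open>v\<close> against the second derivative of a bump of
  height 1 gives the jump \<open>v - w\<close>.\<close>

lemma bump''_corner_integral:
  fixes v w q :: "'a::euclidean_space" and t0 e :: real
  assumes e: "0 < e"
  defines k_def: "k \<equiv> \<lambda>t. q + (t - t0) *\<^sub>R (if t \<le> t0 then w else v)"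
  shows "((\<lambda>t. (bump'' ((t - t0) / e) * (1 / e / e)) *\<^sub>R k t) has_integral (v - w)) {t0 - e..t0 + e}"
proof -
  \<comment> \<open>\<open>P z\<close> is the antiderivative, found by integrating by parts twice,
    for the affine map of slope z. It vanishes at t0 - e and t0 + e and equals -z at t0, so the left
    half contributes -w and the right half v.\<close>
  define P where "P = (\<lambda>z t. (bump' ((t - t0) / e) * (1 / e)) *\<^sub>R (q + (t - t0) *\<^sub>R z)
    - bump ((t - t0) / e) *\<^sub>R (z :: 'a))"
  have DP: "(P z has_vector_derivative (bump'' ((t - t0) / e) * (1 / e / e)) *\<^sub>R (q + (t - t0) *\<^sub>R z)) (at t)" for z t
  proof -
    have lin: "((\<lambda>t. q + (t - t0) *\<^sub>R z) has_vector_derivative z) (at t)"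
      by (auto intro!: derivative_eq_intros)
    have b: "((\<lambda>t. bump ((t - t0) / e)) has_real_derivative bump' ((t - t0) / e) * (1 / e)) (at t)"
      using DERIV_scaled[OF DERIV_bump, of t0 e 1] by simp
    have "((\<lambda>t. bump ((t - t0) / e) *\<^sub>R z) has_vector_derivative (bump' ((t - t0) / e) * (1 / e)) *\<^sub>R z) (at t)"
      using has_vector_derivative_scaleR[OF b has_vector_derivative_const] by simp
    from has_vector_derivative_diff[OF has_vector_derivative_scaleR[OF DERIV_scaled[OF DERIV_bump', of t0 e "1 / e"] lin] this]
    show ?thesis unfolding P_def by simp
  qed
  have F: "((\<lambda>t. (bump'' ((t - t0) / e) * (1 / e / e)) *\<^sub>R (q + (t - t0) *\<^sub>R z)) has_integral P z d - P z c) {c..d}"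
    if "c \<le> d" for c d z
    by (rule fundamental_theorem_of_calculus[OF that has_vector_derivative_at_within[OF DP]])
  have ends: "P z (t0 + e) = 0" "P z (t0 - e) = 0" "P z t0 = - z" for z
    using e scaled_bump_outside[OF e, of "t0 + e" t0] scaled_bump_outside[OF e, of "t0 - e" t0]
    by (simp_all add: P_def bump_0)
  have "((\<lambda>t. (bump'' ((t - t0) / e) * (1 / e / e)) *\<^sub>R k t) has_integral - w) {t0 - e..t0}"
  proof -
    have "((\<lambda>t. (bump'' ((t - t0) / e) * (1 / e / e)) *\<^sub>R (q + (t - t0) *\<^sub>R w)) has_integral - w) {t0 - e..t0}"
      using F[of "t0 - e" t0 w] e by (simp add: ends)
    then show ?thesis
      by (rule has_integral_eq[rotated]) (auto simp: k_def)
  qed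
  moreover have "((\<lambda>t. (bump'' ((t - t0) / e) * (1 / e / e)) *\<^sub>R k t) has_integral v) {t0..t0 + e}"
  proof -
    have "((\<lambda>t. (bump'' ((t - t0) / e) * (1 / e / e)) *\<^sub>R (q + (t - t0) *\<^sub>R v)) has_integral v) {t0..t0 + e}"
      using F[of t0 "t0 + e" v] e by (simp add: ends)
    then show ?thesis
      by (rule has_integral_eq[rotated]) (auto simp: k_def)
  qed
  ultimately show ?thesis
    using has_integral_combine[of "t0 - e" t0 "t0 + e" "\<lambda>t. (bump'' ((t - t0) / e) * (1 / e / e)) *\<^sub>R k t" "- w" v] e
    by simp
qed

text \<open>Let b be the bump rescaled to width e. The two weak derivative identities turn the
  integral of b'' \<gamma> into that of b h, which tends to 0 with e. Replacing \<gamma> by the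
  corner model k gives exactly v - w. Near t0 the curve is within \<eta> |t - t0| of the model, so
  the error is at most 24/e^2 times \<eta> e times the length 2e, that is 48 \<eta>.\<close>

lemma H2_on_no_corner:
  fixes \<gamma> :: "real \<Rightarrow> 'a::euclidean_space"
  assumes H: "H2_on a b \<gamma>" and t0: "a < t0" "t0 < b"
    and v: "(\<gamma> has_vector_derivative v) (at t0 within {t0..b})"
    and w: "(\<gamma> has_vector_derivative w) (at t0 within {a..t0})"
  shows "v = w"
proof -
  from H obtain g h where cont: "continuous_on {a..b} \<gamma>" and h: "L2_on a b h"
    and wd: "weak_deriv_on a b \<gamma> g" "weak_deriv_on a b g h"
    unfolding H2_on_def by blast
  define k where "k = (\<lambda>t. \<gamma> t0 + (t - t0) *\<^sub>R (if t \<le> t0 then w else v))"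
  define J where "J = (\<lambda>e. LINT t:{a..b}|lborel. bump ((t - t0) / e) *\<^sub>R h t)"
  define r where "r = min (t0 - a) (b - t0)"
  have r: "0 < r" using t0 by (simp add: r_def)
  have hm: "set_borel_measurable lborel {a..b} h" using h by (simp add: L2_on_def)
  \<comment> \<open>On a bounded interval L^2 functions are integrable, here through |h| \<le> 1 +
    |h|^2.\<close>
  have hi: "set_integrable lborel {a..b} h"
  proof -
    have "set_integrable lborel {a..b} (\<lambda>t. 1 + (norm (h t))\<^sup>2)"
      using h by (intro set_integral_add(1)) (auto simp: L2_on_def intro!: borel_integrable_atLeastAtMost')
    then show ?thesis
      unfolding set_integrable_def
    proof (rule Bochner_Integration.integrable_bound)
      show "(\<lambda>x. indicator {a..b} x *\<^sub>R h x) \<in> borel_measurable lborel"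
        using hm by (simp add: set_borel_measurable_def)
      have "x \<le> 1 + x\<^sup>2" for x :: real
        using zero_le_power2[of "x - 1/2"] by (simp add: power2_eq_square algebra_simps)
      then show "AE x in lborel. norm (indicator {a..b} x *\<^sub>R h x)
          \<le> norm (indicator {a..b} x *\<^sub>R (1 + (norm (h x))\<^sup>2))"
        by (auto simp: indicator_def)
    qed
  qed
  have test: "(LINT t:{a..b}|lborel. (bump'' ((t - t0) / e) * (1 / e / e)) *\<^sub>R \<gamma> t) = J e"
    if "0 < e" "e < r" for e
  proof -
    have "a < t0 - e" "t0 + e < b" using that by (auto simp: r_def)
    note C = C1c_on_scaled_bump[OF that(1) this]
    from wd(1)[unfolded weak_deriv_on_def, rule_format, OF C(2)]
      wd(2)[unfolded weak_deriv_on_def, rule_format, OF C(1)]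
    show ?thesis unfolding J_def by simp
  qed
  have sub: "(LINT t:{a..b}|lborel. (bump'' ((t - t0) / e) * (1 / e / e)) *\<^sub>R \<gamma> t)
      = integral {t0 - e..t0 + e} (\<lambda>t. (bump'' ((t - t0) / e) * (1 / e / e)) *\<^sub>R \<gamma> t)"
    and int: "(\<lambda>t. (bump'' ((t - t0) / e) * (1 / e / e)) *\<^sub>R \<gamma> t) integrable_on {t0 - e..t0 + e}"
    if e: "0 < e" "e < r" for e
  proof -
    have ab: "a \<le> t0 - e" "t0 + e \<le> b" using e by (auto simp: r_def)
    have "continuous_on {t0 - e..t0 + e} \<gamma>" by (rule continuous_on_subset[OF cont]) (use ab in auto)
    moreover have "continuous_on {t0 - e..t0 + e} (\<lambda>t. (t - t0) / e)"
      using e by (intro continuous_intros) auto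
    ultimately have "continuous_on {t0 - e..t0 + e} (\<lambda>t. (bump'' ((t - t0) / e) * (1 / e / e)) *\<^sub>R \<gamma> t)"
      by (intro continuous_on_scaleR continuous_on_mult_right continuous_on_compose2[OF continuous_on_bump'']) auto
    then have si: "set_integrable lborel {t0 - e..t0 + e} (\<lambda>t. (bump'' ((t - t0) / e) * (1 / e / e)) *\<^sub>R \<gamma> t)"
      by (rule borel_integrable_atLeastAtMost')
    have "(LINT t:{a..b}|lborel. (bump'' ((t - t0) / e) * (1 / e / e)) *\<^sub>R \<gamma> t)
      = (LINT t:{t0 - e..t0 + e}|lborel. (bump'' ((t - t0) / e) * (1 / e / e)) *\<^sub>R \<gamma> t)"
      unfolding set_lebesgue_integral_def
    proof (rule Bochner_Integration.integral_cong)
      fix t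
      show "indicator {a..b} t *\<^sub>R (bump'' ((t - t0) / e) * (1 / e / e)) *\<^sub>R \<gamma> t
        = indicator {t0 - e..t0 + e} t *\<^sub>R (bump'' ((t - t0) / e) * (1 / e / e)) *\<^sub>R \<gamma> t"
        using ab scaled_bump_outside(3)[OF e(1), of t t0] by (cases "t \<in> {t0 - e..t0 + e}") (auto simp: indicator_def)
    qed simp
    also have "\<dots> = integral {t0 - e..t0 + e} (\<lambda>t. (bump'' ((t - t0) / e) * (1 / e / e)) *\<^sub>R \<gamma> t)"
      by (rule set_borel_integral_eq_integral(2)[OF si])
    finally show "(LINT t:{a..b}|lborel. (bump'' ((t - t0) / e) * (1 / e / e)) *\<^sub>R \<gamma> t)
      = integral {t0 - e..t0 + e} (\<lambda>t. (bump'' ((t - t0) / e) * (1 / e / e)) *\<^sub>R \<gamma> t)" .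
    show "(\<lambda>t. (bump'' ((t - t0) / e) * (1 / e / e)) *\<^sub>R \<gamma> t) integrable_on {t0 - e..t0 + e}"
      by (rule set_borel_integral_eq_integral(1)[OF si])
  qed
  \<comment> \<open>The summand 2 keeps every width strictly below r, also for n = 0.\<close>
  have J0: "(\<lambda>n. J (r / (real n + 2))) \<longlonglongrightarrow> 0"
  proof -
    have "(\<lambda>n. LINT t|lborel. indicator {a..b} t *\<^sub>R bump ((t - t0) / (r / (real n + 2))) *\<^sub>R h t)
        \<longlonglongrightarrow> (LINT t|lborel. (\<lambda>_. 0 :: 'a) (t :: real))"
    proof (rule integral_dominated_convergence)
      show "integrable lborel (\<lambda>t. norm (indicator {a..b} t *\<^sub>R h t))"
        using hi unfolding set_integrable_def by (rule integrable_norm)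
      show "(\<lambda>t. indicator {a..b} t *\<^sub>R bump ((t - t0) / (r / (real n + 2))) *\<^sub>R h t) \<in> borel_measurable lborel" for n
      proof -
        have "isCont (\<lambda>t. bump ((t - t0) / (r / (real n + 2))) * 1) x" for x
          by (rule DERIV_isCont[OF DERIV_scaled[OF DERIV_bump]])
        then have "(\<lambda>t. bump ((t - t0) / (r / (real n + 2)))) \<in> borel_measurable lborel"
          by (simp add: borel_measurable_continuous_onI continuous_at_imp_continuous_on)
        then have "(\<lambda>t. bump ((t - t0) / (r / (real n + 2))) *\<^sub>R (indicator {a..b} t *\<^sub>R h t)) \<in> borel_measurable lborel"
          using hm unfolding set_borel_measurable_def by (rule borel_measurable_scaleR)
        then show ?thesis by (simp add: mult.commute)
      qed
      show "AE t in lborel. norm (indicator {a..b} t *\<^sub>R bump ((t - t0) / (r / (real n + 2))) *\<^sub>R h t)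
          \<le> norm (indicator {a..b} t *\<^sub>R h t)" for n
        using bump_bounds(1,2) by (intro AE_I2) (auto simp: indicator_def mult_left_le_one_le)
      \<comment> \<open>At t0 the bump equals 1 for every width; elsewhere it is eventually 0, and a
        single point is null.\<close>
      have "AE t in lborel. t \<noteq> t0" by (rule AE_lborel_singleton)
      then show "AE t in lborel. (\<lambda>n. indicator {a..b} t *\<^sub>R bump ((t - t0) / (r / (real n + 2))) *\<^sub>R h t)
          \<longlonglongrightarrow> (\<lambda>_. 0 :: 'a) t"
      proof eventually_elim
        case (elim t)
        obtain N :: nat where N: "r / \<bar>t - t0\<bar> < real N" using reals_Archimedean2 by blast
        have "bump ((t - t0) / (r / (real n + 2))) = 0" if "N \<le> n" for n
        proof -
          have "r < real N * \<bar>t - t0\<bar>" using N elim by (simp add: pos_divide_less_eq)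
          also have "\<dots> \<le> (real n + 2) * \<bar>t - t0\<bar>" using that by (intro mult_right_mono) auto
          finally have "r / (real n + 2) < \<bar>t - t0\<bar>" by (simp add: pos_divide_less_eq mult.commute)
          then show ?thesis using r by (intro scaled_bump_outside) auto
        qed
        then have "\<forall>\<^sub>F n in sequentially. indicator {a..b} t *\<^sub>R bump ((t - t0) / (r / (real n + 2))) *\<^sub>R h t = 0"
          unfolding eventually_sequentially by (intro exI[of _ N]) auto
        then show ?case by (simp add: tendsto_eventually)
      qed
    qed simp
    then show ?thesis unfolding J_def set_lebesgue_integral_def by simp
  qed
  have bound: "norm (v - w) \<le> 48 * \<eta>" if \<eta>: "0 < \<eta>" for \<eta>
  proof -
    have "\<exists>d>0. \<forall>t. \<bar>t - t0\<bar> < d \<longrightarrow> a \<le> t \<longrightarrow> t \<le> b \<longrightarrow> norm (\<gamma> t - k t) \<le> \<eta> * \<bar>t - t0\<bar>"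
    proof -
      obtain d1 where d1: "0 < d1" "\<And>t. t \<in> {t0..b} \<Longrightarrow> norm (t - t0) < d1 \<Longrightarrow>
          norm (\<gamma> t - \<gamma> t0 - (t - t0) *\<^sub>R v) \<le> \<eta> * norm (t - t0)"
        using v[unfolded has_vector_derivative_def has_derivative_within_alt, THEN conjunct2, rule_format, OF \<eta>]
        by blast
      obtain d2 where d2: "0 < d2" "\<And>t. t \<in> {a..t0} \<Longrightarrow> norm (t - t0) < d2 \<Longrightarrow>
          norm (\<gamma> t - \<gamma> t0 - (t - t0) *\<^sub>R w) \<le> \<eta> * norm (t - t0)"
        using w[unfolded has_vector_derivative_def has_derivative_within_alt, THEN conjunct2, rule_format, OF \<eta>]
        by blast
      show ?thesis
      proof (intro exI[of _ "min d1 d2"] conjI allI impI)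
        fix t assume t: "\<bar>t - t0\<bar> < min d1 d2" "a \<le> t" "t \<le> b"
        show "norm (\<gamma> t - k t) \<le> \<eta> * \<bar>t - t0\<bar>"
          using d1(2)[of t] d2(2)[of t] t by (cases "t \<le> t0") (auto simp: k_def diff_diff_eq)
      qed (use d1 d2 in auto)
    qed
    then obtain d where d: "0 < d" "\<And>t. \<bar>t - t0\<bar> < d \<Longrightarrow> a \<le> t \<Longrightarrow> t \<le> b \<Longrightarrow> norm (\<gamma> t - k t) \<le> \<eta> * \<bar>t - t0\<bar>"
      by blast
    have step: "norm (v - w) \<le> norm (J e) + 48 * \<eta>" if e: "0 < e" "e < r" "e < d" for e
    proof -
      define B where "B = (\<lambda>t. bump'' ((t - t0) / e) * (1 / e / e))"
      have hk: "((\<lambda>t. B t *\<^sub>R k t) has_integral (v - w)) {t0 - e..t0 + e}"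
        unfolding B_def k_def by (rule bump''_corner_integral[OF e(1)])
      have "((\<lambda>t. B t *\<^sub>R \<gamma> t) has_integral J e) {t0 - e..t0 + e}"
        using integrable_integral[OF int[OF e(1,2)]] sub[OF e(1,2)] test[OF e(1,2)] unfolding B_def by simp
      from has_integral_diff[OF this hk]
      have I: "((\<lambda>t. B t *\<^sub>R (\<gamma> t - k t)) has_integral J e - (v - w)) {t0 - e..t0 + e}"
        by (simp add: scaleR_diff_right)
      have "norm (J e - (v - w)) \<le> (24 * (1 / e / e) * (\<eta> * e)) * measure lborel {t0 - e..t0 + e}"
      proof (rule has_integral_bound_real[OF _ finite.emptyI I])
        show "norm (B t *\<^sub>R (\<gamma> t - k t)) \<le> 24 * (1 / e / e) * (\<eta> * e)" if t: "t \<in> {t0 - e..t0 + e} - {}" for t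
        proof -
          from t have te: "\<bar>t - t0\<bar> \<le> e" by auto
          have "norm (\<gamma> t - k t) \<le> \<eta> * \<bar>t - t0\<bar>"
            using t e by (intro d) (auto simp: r_def)
          also have "\<dots> \<le> \<eta> * e" using te \<eta> by simp
          finally have 1: "norm (\<gamma> t - k t) \<le> \<eta> * e" .
          have 2: "\<bar>B t\<bar> \<le> 24 * (1 / e / e)"
            unfolding B_def abs_mult using e bump_bounds(3)[of "(t - t0) / e"] by (simp add: divide_right_mono)
          show "norm (B t *\<^sub>R (\<gamma> t - k t)) \<le> 24 * (1 / e / e) * (\<eta> * e)"
            unfolding norm_scaleR by (intro mult_mono 1 2) (use e in auto)
        qed
      qed (use e \<eta> in auto)
      also have "\<dots> = 48 * \<eta>" using e by (simp add: field_simps)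
      finally have "norm (J e - (v - w)) \<le> 48 * \<eta>" .
      moreover have "norm (v - w) \<le> norm (J e) + norm (J e - (v - w))"
        by (metis norm_minus_commute norm_triangle_sub)
      ultimately show ?thesis by simp
    qed
    have "(\<lambda>n. norm (J (r / (real n + 2))) + 48 * \<eta>) \<longlonglongrightarrow> norm (0 :: 'a) + 48 * \<eta>"
      by (intro tendsto_intros J0)
    moreover have "\<exists>N. \<forall>n\<ge>N. norm (v - w) \<le> norm (J (r / (real n + 2))) + 48 * \<eta>"
    proof -
      obtain N :: nat where N: "r / d < real N" using reals_Archimedean2 by blast
      show ?thesis
      proof (intro exI[of _ N] allI impI step)
        fix n assume n: "N \<le> n"
        show "0 < r / (real n + 2)" "r / (real n + 2) < r" using r by (auto simp: pos_divide_less_eq)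
        have "r < real N * d" using N d by (simp add: pos_divide_less_eq)
        also have "\<dots> \<le> (real n + 2) * d" using n d by (intro mult_right_mono) auto
        finally show "r / (real n + 2) < d" by (simp add: pos_divide_less_eq mult.commute)
      qed
    qed
    ultimately have "norm (v - w) \<le> norm (0 :: 'a) + 48 * \<eta>" by (rule LIMSEQ_le_const)
    then show ?thesis by simp
  qed
  have "norm (v - w) \<le> 0"
  proof (rule field_le_epsilon)
    fix e :: real assume "0 < e"
    with bound[of "e / 48"] show "norm (v - w) \<le> 0 + e" by simp
  qed
  then show ?thesis by simp
qed

section \<open>Arclength and the normal form of figure-eight elasticae\<close>

text \<open>\<open>arclength\<close> is built from \<open>vector_derivative\<close>; any given
  derivative g may stand for it, since derivatives within a nondegenerate closed interval are
  unique.\<close>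

lemma
  fixes \<gamma> :: "real \<Rightarrow> 'a::euclidean_space"
  assumes ab: "a < b" and g: "continuous_on {a..b} g"
    and D: "\<And>t. t \<in> {a..b} \<Longrightarrow> (\<gamma> has_vector_derivative g t) (at t within {a..b})"
  shows arclength_eq: "t \<in> {a..b} \<Longrightarrow> arclength a b \<gamma> t = integral {a..t} (\<lambda>u. norm (g u))"
    and DERIV_arclength: "t \<in> {a..b} \<Longrightarrow> (arclength a b \<gamma> has_real_derivative norm (g t)) (at t within {a..b})"
proof -
  have vd: "vector_derivative \<gamma> (at t within {a..b}) = g t" if "t \<in> {a..b}" for t
    by (rule vector_derivative_within_closed_interval[OF ab that D[OF that]])
  show eq: "arclength a b \<gamma> t = integral {a..t} (\<lambda>u. norm (g u))" if "t \<in> {a..b}" for t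
    unfolding arclength_def using that by (intro integral_cong) (simp add: vd)
  assume t: "t \<in> {a..b}"
  have "continuous_on {a..b} (\<lambda>u. norm (g u))" by (intro continuous_intros g)
  from integral_has_real_derivative[OF this t]
  show "(arclength a b \<gamma> has_real_derivative norm (g t)) (at t within {a..b})"
    by (rule has_field_derivative_transform_within[of _ _ _ _ 1]) (use t in \<open>auto simp: eq\<close>)
qed

lemma arclength_left: "arclength a b \<gamma> a = 0"
  by (simp add: arclength_def)

text \<open>Positive speed makes arclength strictly increasing. The image is what transfers facts
  between the parameter t and the arclength s in both directions.\<close>

lemma
  fixes \<gamma> :: "real \<Rightarrow> 'a::euclidean_space"
  assumes ab: "a < b" and g: "continuous_on {a..b} g"
    and D: "\<And>t. t \<in> {a..b} \<Longrightarrow> (\<gamma> has_vector_derivative g t) (at t within {a..b})"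
    and nz: "\<And>t. t \<in> {a..b} \<Longrightarrow> g t \<noteq> 0"
  shows curve_length_pos: "0 < curve_length a b \<gamma>"
    and arclength_image: "arclength a b \<gamma> ` {a..b} = {0..curve_length a b \<gamma>}"
proof -
  have cont: "continuous_on {a..b} (arclength a b \<gamma>)"
    by (rule DERIV_continuous_on[OF DERIV_arclength[OF ab g D]])
  have less: "arclength a b \<gamma> s < arclength a b \<gamma> t" if "a \<le> s" "s < t" "t \<le> b" for s t
  proof (rule DERIV_pos_imp_increasing_open[OF \<open>s < t\<close>])
    show "continuous_on {s..t} (arclength a b \<gamma>)"
      by (rule continuous_on_subset[OF cont]) (use that in auto)
    fix x assume x: "s < x" "x < t"
    then have "x \<in> {a..b}" "at x within {a..b} = at x" using that by (auto intro!: at_within_Icc_at)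
    then show "\<exists>y. (arclength a b \<gamma> has_real_derivative y) (at x) \<and> 0 < y"
      using DERIV_arclength[OF ab g D, of x] nz[of x] by (intro exI[of _ "norm (g x)"]) simp
  qed
  from less[of a b] ab show pos: "0 < curve_length a b \<gamma>"
    by (simp add: curve_length_def arclength_left)
  have le: "arclength a b \<gamma> s \<le> arclength a b \<gamma> t" if "a \<le> s" "s \<le> t" "t \<le> b" for s t
    using less[of s t] that by (cases "s = t") auto
  show "arclength a b \<gamma> ` {a..b} = {0..curve_length a b \<gamma>}"
  proof (intro equalityI subsetI)
    fix y assume "y \<in> arclength a b \<gamma> ` {a..b}"
    then show "y \<in> {0..curve_length a b \<gamma>}"
      using le[of a] le[of _ b] by (auto simp: curve_length_def arclength_left)
  next
    fix y assume "y \<in> {0..curve_length a b \<gamma>}"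
    then have "\<exists>x. a \<le> x \<and> x \<le> b \<and> arclength a b \<gamma> x = y"
      using ab by (intro IVT' cont) (auto simp: curve_length_def arclength_left)
    then show "y \<in> arclength a b \<gamma> ` {a..b}" by auto
  qed
qed

section \<open>Frames of the plane and the normal form\<close>

text \<open>Turns membership in the plane into an equation, which can be differentiated along a
  curve.\<close>

lemma span_orthonormal_pair:
  fixes e1 e2 :: "'a::euclidean_space"
  assumes "norm e1 = 1" "norm e2 = 1" "e1 \<bullet> e2 = 0"
  shows "x \<in> span {e1, e2} \<longleftrightarrow> x = (x \<bullet> e1) *\<^sub>R e1 + (x \<bullet> e2) *\<^sub>R e2"
proof
  assume "x \<in> span {e1, e2}"
  then obtain k l where "x - k *\<^sub>R e1 = l *\<^sub>R e2"
    by (auto simp: span_insert span_singleton)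
  then have x: "x = k *\<^sub>R e1 + l *\<^sub>R e2" by (simp add: algebra_simps)
  have "e1 \<bullet> e1 = 1" "e2 \<bullet> e2 = 1" "e2 \<bullet> e1 = 0"
    using assms by (simp_all add: dot_square_norm inner_commute)
  then have "x \<bullet> e1 = k" "x \<bullet> e2 = l"
    using assms(3) by (simp_all add: x inner_add_left)
  with x show "x = (x \<bullet> e1) *\<^sub>R e1 + (x \<bullet> e2) *\<^sub>R e2" by simp
next
  assume *: "x = (x \<bullet> e1) *\<^sub>R e1 + (x \<bullet> e2) *\<^sub>R e2"
  show "x \<in> span {e1, e2}"
    by (subst *) (intro span_add span_scale span_base; simp)
qed

text \<open>The explicit elastica for \<open>mstar\<close>, placed in a frame with its crossing
  point at the origin. Replacing f2 by -f2 reverses the sign of the curvature, so one formula covers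
  both signs.\<close>

definition figZ :: "'a::euclidean_space \<Rightarrow> 'a \<Rightarrow> real \<Rightarrow> 'a" where
  "figZ f1 f2 u = elasX mstar u *\<^sub>R f1 + elasY mstar u *\<^sub>R f2"

definition figT :: "'a::euclidean_space \<Rightarrow> 'a \<Rightarrow> real \<Rightarrow> 'a" where
  "figT f1 f2 u = elasA mstar u *\<^sub>R f1 + elasB mstar u *\<^sub>R f2"

lemma figZ_deriv: "(figZ f1 f2 has_vector_derivative figT f1 f2 u) (at u)"
proof -
  have "((\<lambda>u. elasX mstar u *\<^sub>R f1 + elasY mstar u *\<^sub>R f2) has_vector_derivative
      (elasX mstar u *\<^sub>R 0 + elasA mstar u *\<^sub>R f1) + (elasY mstar u *\<^sub>R 0 + elasB mstar u *\<^sub>R f2)) (at u)"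
    by (intro has_vector_derivative_add has_vector_derivative_scaleR has_vector_derivative_const
        DERIV_elasX[OF mstar_bounds] DERIV_elasY[OF mstar_bounds])
  then show ?thesis by (simp add: figZ_def[abs_def] figT_def)
qed

definition orthonormal_pair :: "'a::euclidean_space \<Rightarrow> 'a \<Rightarrow> bool" where
  "orthonormal_pair f1 f2 \<longleftrightarrow> norm f1 = 1 \<and> norm f2 = 1 \<and> f1 \<bullet> f2 = 0"

text \<open>In complex notation with respect to (e1, e2), the tangent x + iy and the model tangent A
  + iB both solve z' = i \<sigma> k z, so their quotient P + iQ is constant and of modulus one: T is
  a fixed rotation of the model. The rotation and the sign \<sigma> are absorbed into (f1, f2), and
  integrating T leaves only the translation q. The factor \<Lambda> converts arclength into the
  phase of the model.\<close>

lemma fig8_elastica_normal_form: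
  fixes \<gamma> :: "real \<Rightarrow> 'a::euclidean_space"
  assumes fig: "fig8_elastica N a b \<gamma>" and g: "continuous_on {a..b} g"
    and D: "\<And>t. t \<in> {a..b} \<Longrightarrow> (\<gamma> has_vector_derivative g t) (at t within {a..b})"
    and nz: "\<And>t. t \<in> {a..b} \<Longrightarrow> g t \<noteq> 0"
  defines "\<Lambda> \<equiv> 2 * ellK mstar * real N / curve_length a b \<gamma>"
  obtains q f1 f2 where "orthonormal_pair f1 f2"
    "\<And>t. t \<in> {a..b} \<Longrightarrow> \<gamma> t = q + (1 / \<Lambda>) *\<^sub>R figZ f1 f2 (\<Lambda> * arclength a b \<gamma> t - ellK mstar)"
    "\<And>t. t \<in> {a..b} \<Longrightarrow> g t = norm (g t) *\<^sub>R figT f1 f2 (\<Lambda> * arclength a b \<gamma> t - ellK mstar)"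
proof -
  define L where "L = curve_length a b \<gamma>"
  define S where "S = arclength a b \<gamma>"
  define k where "k = fig8_curvature N L"
  from fig obtain p e1 e2 \<sigma> c T where N: "0 < N" and ab: "a < b"
    and plane: "in_plane p e1 e2 a b \<gamma>" and \<sigma>: "\<sigma> = 1 \<or> \<sigma> = -1"
    and c: "\<And>t. t \<in> {a..b} \<Longrightarrow> \<gamma> t = c (S t)"
    and dc: "\<And>s. s \<in> {0..L} \<Longrightarrow> (c has_vector_derivative T s) (at s within {0..L})"
    and dT: "\<And>s. s \<in> {0..L} \<Longrightarrow> (T has_vector_derivative (\<sigma> * k s) *\<^sub>R rot90 e1 e2 (T s)) (at s within {0..L})"
    unfolding fig8_elastica_def has_signed_curvature_def L_def S_def k_def by blast
  have e: "norm e1 = 1" "norm e2 = 1" "e1 \<bullet> e2 = 0" and sp: "\<And>t. t \<in> {a..b} \<Longrightarrow> \<gamma> t - p \<in> span {e1, e2}"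
    using plane unfolding in_plane_def by auto
  have ee: "e1 \<bullet> e1 = 1" "e2 \<bullet> e2 = 1" "e2 \<bullet> e1 = 0"
    using e by (simp_all add: dot_square_norm inner_commute)
  have L: "0 < L" unfolding L_def by (rule curve_length_pos[OF ab g D nz])
  have img: "S ` {a..b} = {0..L}" unfolding S_def L_def by (rule arclength_image[OF ab g D nz])
  have dS: "(S has_real_derivative norm (g t)) (at t within {a..b})" if "t \<in> {a..b}" for t
    unfolding S_def by (rule DERIV_arclength[OF ab g D that])
  have \<Lambda>: "0 < \<Lambda>" "\<Lambda> = 2 * ellK mstar * real N / L"
    using L N ellK_pos[OF mstar_bounds] by (simp_all add: \<Lambda>_def L_def)
  have k: "k s = 2 * sqrt mstar * \<Lambda> * cn (\<Lambda> * s - ellK mstar) mstar" for s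
    unfolding k_def fig8_curvature_def Let_def \<Lambda>(2) by simp
  \<comment> \<open>The chain rule for c \<circ> S gives a second derivative of \<gamma> within the
    same interval, and the two must agree.\<close>
  have gT: "g t = norm (g t) *\<^sub>R T (S t)" if t: "t \<in> {a..b}" for t
  proof -
    have St: "S t \<in> {0..L}" using img t by auto
    have "(c \<circ> S has_vector_derivative norm (g t) *\<^sub>R T (S t)) (at t within {a..b})"
      using vector_diff_chain_within[OF dS[OF t, unfolded has_real_derivative_iff_has_vector_derivative]] dc[OF St]
      unfolding img by blast
    moreover have "(c \<circ> S has_vector_derivative g t) (at t within {a..b})"
      by (rule has_vector_derivative_transform[OF t _ D[OF t]]) (simp add: c)
    ultimately show ?thesis
      using vector_derivative_within_closed_interval[OF ab t] by metis
  qed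
  \<comment> \<open>Unit length follows from |g| = |g| |T| with g nonzero. For planarity, the
    identity equating \<gamma> - p with its projection onto the plane is differentiated.\<close>
  have T: "norm (T s) = 1" "T s \<in> span {e1, e2}" if s: "s \<in> {0..L}" for s
  proof -
    obtain t where t: "t \<in> {a..b}" "s = S t" using img s by (metis imageE)
    have "norm (g t) = norm (g t) * norm (T s)" using arg_cong[OF gT[OF t(1)], of norm] t(2) by simp
    with nz[OF t(1)] show "norm (T s) = 1" by simp
    have inn: "((\<lambda>t. (\<gamma> t - p) \<bullet> v) has_vector_derivative (g t - 0) \<bullet> v) (at t within {a..b})" for v
      by (intro bounded_linear.has_vector_derivative[OF bounded_linear_inner_left] has_vector_derivative_diff
          has_vector_derivative_const D t)
    have "((\<lambda>t. (\<gamma> t - p) - (((\<gamma> t - p) \<bullet> e1) *\<^sub>R e1 + ((\<gamma> t - p) \<bullet> e2) *\<^sub>R e2)) has_vector_derivative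
      (g t - 0) - (((g t - 0) \<bullet> e1) *\<^sub>R e1 + ((g t - 0) \<bullet> e2) *\<^sub>R e2)) (at t within {a..b})"
      by (intro has_vector_derivative_diff has_vector_derivative_add has_vector_derivative_const D t
          bounded_linear.has_vector_derivative[OF bounded_linear_scaleR_left] inn)
    moreover have "(\<gamma> t - p) - (((\<gamma> t - p) \<bullet> e1) *\<^sub>R e1 + ((\<gamma> t - p) \<bullet> e2) *\<^sub>R e2) = 0" if "t \<in> {a..b}" for t
      using sp[OF that] span_orthonormal_pair[OF e] by simp
    ultimately have "((\<lambda>t. 0) has_vector_derivative
      g t - ((g t \<bullet> e1) *\<^sub>R e1 + (g t \<bullet> e2) *\<^sub>R e2)) (at t within {a..b})"
      using has_vector_derivative_transform[OF t(1)] by (metis (no_types, lifting) diff_zero)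
    then have "g t - ((g t \<bullet> e1) *\<^sub>R e1 + (g t \<bullet> e2) *\<^sub>R e2) = 0"
      using vector_derivative_within_closed_interval[OF ab t(1)] has_vector_derivative_const by metis
    then have "g t \<in> span {e1, e2}" using span_orthonormal_pair[OF e] by simp
    then have "(1 / norm (g t)) *\<^sub>R g t \<in> span {e1, e2}" by (rule span_scale)
    moreover have "(1 / norm (g t)) *\<^sub>R g t = T s"
      using nz[OF t(1)] t(2) by (subst gT[OF t(1)]) simp
    ultimately show "T s \<in> span {e1, e2}" by simp
  qed
  define x where "x = (\<lambda>s. T s \<bullet> e1)"
  define y where "y = (\<lambda>s. T s \<bullet> e2)"
  define A where "A = (\<lambda>s. elasA mstar (\<Lambda> * s - ellK mstar))"
  \<comment> \<open>With the sign included, (A, B) solves the system with curvature \<sigma> k, the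
    same one as T.\<close>
  define B where "B = (\<lambda>s. \<sigma> * elasB mstar (\<Lambda> * s - ellK mstar))"
  have Txy: "T s = x s *\<^sub>R e1 + y s *\<^sub>R e2" if "s \<in> {0..L}" for s
    using T(2)[OF that] span_orthonormal_pair[OF e] by (simp add: x_def y_def)
  have dx: "(x has_real_derivative - (\<sigma> * k s) * y s) (at s within {0..L})"
    and dy: "(y has_real_derivative (\<sigma> * k s) * x s) (at s within {0..L})" if s: "s \<in> {0..L}" for s
  proof -
    have "((\<lambda>s. T s \<bullet> v) has_vector_derivative ((\<sigma> * k s) *\<^sub>R rot90 e1 e2 (T s)) \<bullet> v) (at s within {0..L})" for v
      by (rule bounded_linear.has_vector_derivative[OF bounded_linear_inner_left dT[OF s]])
    from this[of e1] this[of e2]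
    show "(x has_real_derivative - (\<sigma> * k s) * y s) (at s within {0..L})"
      "(y has_real_derivative (\<sigma> * k s) * x s) (at s within {0..L})"
      unfolding has_real_derivative_iff_has_vector_derivative x_def y_def rot90_def
      by (simp_all add: inner_diff_left ee e(3) algebra_simps)
  qed
  have lin: "((\<lambda>s. \<Lambda> * s - ellK mstar) has_real_derivative \<Lambda>) (at s within {0..L})" for s
    by (auto intro!: derivative_eq_intros)
  have dA: "(A has_real_derivative - (\<sigma> * k s) * B s) (at s within {0..L})" for s
    unfolding A_def by (rule DERIV_cong[OF DERIV_chain2[OF DERIV_elasA[OF mstar_bounds] lin]])
      (use \<sigma> in \<open>auto simp: B_def k\<close>)
  have dB: "(B has_real_derivative (\<sigma> * k s) * A s) (at s within {0..L})" for s
    unfolding B_def by (rule DERIV_cong[OF DERIV_cmult[OF DERIV_chain2[OF DERIV_elasB[OF mstar_bounds] lin]]])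
      (simp add: A_def k)
  have AB: "A s * A s + B s * B s = 1" for s
    using elasAB_unit[OF mstar_bounds, of "\<Lambda> * s - ellK mstar"] \<sigma> by (auto simp: A_def B_def power2_eq_square)
  have "((\<lambda>s. x s * A s + y s * B s) has_vector_derivative 0) (at s within {0..L})" if "s \<in> {0..L}" for s
    using DERIV_add[OF DERIV_mult[OF dx[OF that] dA] DERIV_mult[OF dy[OF that] dB]]
    by (simp add: has_real_derivative_iff_has_vector_derivative algebra_simps)
  then obtain P where P: "\<And>s. s \<in> {0..L} \<Longrightarrow> x s * A s + y s * B s = P"
    using has_vector_derivative_zero_constant[of "{0..L}" "\<lambda>s. x s * A s + y s * B s"] by auto
  have "((\<lambda>s. y s * A s - x s * B s) has_vector_derivative 0) (at s within {0..L})" if "s \<in> {0..L}" for s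
    using DERIV_diff[OF DERIV_mult[OF dy[OF that] dA] DERIV_mult[OF dx[OF that] dB]]
    by (simp add: has_real_derivative_iff_has_vector_derivative algebra_simps)
  then obtain Q where Q: "\<And>s. s \<in> {0..L} \<Longrightarrow> y s * A s - x s * B s = Q"
    using has_vector_derivative_zero_constant[of "{0..L}" "\<lambda>s. y s * A s - x s * B s"] by auto
  define f1 where "f1 = P *\<^sub>R e1 + Q *\<^sub>R e2"
  define f2 where "f2 = \<sigma> *\<^sub>R (P *\<^sub>R e2 - Q *\<^sub>R e1)"
  \<comment> \<open>Multiplying P + iQ by A + iB and using A^2 + B^2 = 1 recovers x + iy.\<close>
  have xs: "x s = P * A s - Q * B s" and ys: "y s = P * B s + Q * A s" if s: "s \<in> {0..L}" for s
  proof -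
    have "P * A s - Q * B s = x s * (A s * A s + B s * B s)"
      unfolding P[OF s, symmetric] Q[OF s, symmetric] by (simp add: algebra_simps)
    then show "x s = P * A s - Q * B s" by (simp add: AB)
    have "P * B s + Q * A s = y s * (A s * A s + B s * B s)"
      unfolding P[OF s, symmetric] Q[OF s, symmetric] by (simp add: algebra_simps)
    then show "y s = P * B s + Q * A s" by (simp add: AB)
  qed
  have TF: "T s = figT f1 f2 (\<Lambda> * s - ellK mstar)" if s: "s \<in> {0..L}" for s
    unfolding Txy[OF s] xs[OF s] ys[OF s] figT_def f1_def f2_def A_def B_def using \<sigma>
    by (auto simp: algebra_simps)
  have PQ: "P * P + Q * Q = 1"
  proof -
    have 0: "0 \<in> {0..L}" using L by simp
    have "P * P + Q * Q = (x 0 * x 0 + y 0 * y 0) * (A 0 * A 0 + B 0 * B 0)"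
      unfolding P[OF 0, symmetric] Q[OF 0, symmetric] by (simp add: algebra_simps)
    also have "x 0 * x 0 + y 0 * y 0 = T 0 \<bullet> T 0"
      unfolding Txy[OF 0] by (simp add: inner_add_left inner_add_right ee e(3))
    also have "\<dots> = 1" using T(1)[OF 0] by (simp add: dot_square_norm)
    finally show ?thesis by (simp add: AB)
  qed
  have "f1 \<bullet> f1 = 1" "f2 \<bullet> f2 = 1" "f1 \<bullet> f2 = 0"
    using PQ \<sigma> by (auto simp: f1_def f2_def inner_add_left inner_add_right inner_diff_left inner_diff_right ee e(3) algebra_simps)
  then have f: "orthonormal_pair f1 f2"
    by (simp add: orthonormal_pair_def norm_eq_sqrt_inner)
  have "((\<lambda>s. c s - (1 / \<Lambda>) *\<^sub>R figZ f1 f2 (\<Lambda> * s - ellK mstar)) has_vector_derivative 0) (at s within {0..L})"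
    if s: "s \<in> {0..L}" for s
  proof -
    have "(figZ f1 f2 \<circ> (\<lambda>s. \<Lambda> * s - ellK mstar) has_vector_derivative
        \<Lambda> *\<^sub>R figT f1 f2 (\<Lambda> * s - ellK mstar)) (at s within {0..L})"
      using vector_diff_chain_within[OF lin[unfolded has_real_derivative_iff_has_vector_derivative]
          has_vector_derivative_at_within[OF figZ_deriv]] .
    from bounded_linear.has_vector_derivative[OF bounded_linear_scaleR_right this, of "1 / \<Lambda>"]
    have "((\<lambda>s. (1 / \<Lambda>) *\<^sub>R figZ f1 f2 (\<Lambda> * s - ellK mstar)) has_vector_derivative T s) (at s within {0..L})"
      using \<Lambda>(1) by (simp add: TF[OF s])
    from has_vector_derivative_diff[OF dc[OF s] this] show ?thesis by simp
  qed
  then obtain q where q: "\<And>s. s \<in> {0..L} \<Longrightarrow> c s - (1 / \<Lambda>) *\<^sub>R figZ f1 f2 (\<Lambda> * s - ellK mstar) = q"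
    using has_vector_derivative_zero_constant[of "{0..L}" "\<lambda>s. c s - (1 / \<Lambda>) *\<^sub>R figZ f1 f2 (\<Lambda> * s - ellK mstar)"] by auto
  show thesis
  proof (rule that[OF f])
    fix t assume t: "t \<in> {a..b}"
    then have St: "S t \<in> {0..L}" using img by auto
    show "\<gamma> t = q + (1 / \<Lambda>) *\<^sub>R figZ f1 f2 (\<Lambda> * arclength a b \<gamma> t - ellK mstar)"
      using q[OF St] c[OF t] by (simp add: S_def algebra_simps)
    show "g t = norm (g t) *\<^sub>R figT f1 f2 (\<Lambda> * arclength a b \<gamma> t - ellK mstar)"
      using gT[OF t] TF[OF St] by (simp add: S_def)
  qed
qed

section \<open>Closed leafed elasticae\<close>

lemma figZ_pm_K: "figZ f1 f2 (ellK mstar) = 0" "figZ f1 f2 (- ellK mstar) = 0"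
  by (simp_all add: figZ_def elasX_pm_K elasY_pm_K[OF mstar_bounds])

lemma figZ_add_2K: "figZ f1 f2 (u + 2 * ellK mstar) = figZ f1 (- f2) u"
  by (simp add: figZ_def elasX_add_2K elasY_add_2K[OF mstar_bounds])

lemma figT_pm_K:
  "figT f1 f2 (ellK mstar) = (1 - 2 * mstar) *\<^sub>R f1 + (2 * sqrt mstar * sqrt (1 - mstar)) *\<^sub>R f2"
  "figT f1 f2 (- ellK mstar) = (1 - 2 * mstar) *\<^sub>R f1 - (2 * sqrt mstar * sqrt (1 - mstar)) *\<^sub>R f2"
  by (simp_all add: figT_def elasA_pm_K[OF mstar_bounds] elasB_pm_K[OF mstar_bounds])

lemma norm_figT:
  assumes "orthonormal_pair f1 f2" shows "norm (figT f1 f2 u) = 1"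
proof -
  have "f1 \<bullet> f1 = 1" "f2 \<bullet> f2 = 1" "f1 \<bullet> f2 = 0" "f2 \<bullet> f1 = 0"
    using assms by (simp_all add: orthonormal_pair_def dot_square_norm inner_commute)
  then have "figT f1 f2 u \<bullet> figT f1 f2 u = 1"
    using elasAB_unit[OF mstar_bounds, of u]
    by (simp add: figT_def inner_add_left inner_add_right power2_eq_square)
  then show ?thesis by (simp add: norm_eq_sqrt_inner)
qed

text \<open>Since \<open>m* \<noteq> 1/2\<close>, the end tangents of a leaf determine its frame; this is what forces
  consecutive leaves into a common plane.\<close>

lemma figT_pm_K_frame:
  fixes f1 f2 h1 h2 :: "'a::euclidean_space"
  assumes "figT f1 f2 (ellK mstar) = figT h1 h2 (- ellK mstar)"
    and "figT f1 f2 (- ellK mstar) = figT h1 h2 (ellK mstar)"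
  shows "h1 = f1" "h2 = - f2"
proof -
  define \<alpha> where "\<alpha> = 1 - 2 * mstar"
  define \<beta> where "\<beta> = 2 * sqrt mstar * sqrt (1 - mstar)"
  have nz: "\<alpha> \<noteq> 0" "\<beta> \<noteq> 0" using mstar_gt_half mstar_less_1 by (auto simp: \<alpha>_def \<beta>_def)
  have 1: "\<alpha> *\<^sub>R f1 + \<beta> *\<^sub>R f2 = \<alpha> *\<^sub>R h1 - \<beta> *\<^sub>R h2" "\<alpha> *\<^sub>R f1 - \<beta> *\<^sub>R f2 = \<alpha> *\<^sub>R h1 + \<beta> *\<^sub>R h2"
    using assms by (simp_all add: figT_pm_K \<alpha>_def \<beta>_def)
  have two: "(2 * c) *\<^sub>R x = c *\<^sub>R x + c *\<^sub>R x" for c and x :: 'a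
    by (simp only: mult_2 scaleR_add_left)
  \<comment> \<open>Sum and difference of the two equations isolate \<alpha> h1 and \<beta>
    h2.\<close>
  have "(2 * \<alpha>) *\<^sub>R h1 = (\<alpha> *\<^sub>R h1 - \<beta> *\<^sub>R h2) + (\<alpha> *\<^sub>R h1 + \<beta> *\<^sub>R h2)" unfolding two by simp
  also have "\<dots> = (2 * \<alpha>) *\<^sub>R f1" unfolding 1[symmetric] two by simp
  finally show "h1 = f1" using nz(1) by (simp only: scaleR_cancel_left) simp
  have "(2 * \<beta>) *\<^sub>R h2 = (\<alpha> *\<^sub>R h1 + \<beta> *\<^sub>R h2) - (\<alpha> *\<^sub>R h1 - \<beta> *\<^sub>R h2)" unfolding two by simp
  also have "\<dots> = (2 * \<beta>) *\<^sub>R (- f2)" unfolding 1[symmetric] two by simp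
  finally show "h2 = - f2" using nz(2) by (simp only: scaleR_cancel_left) simp
qed

text \<open>The components along f1 give c = d and those along f2 give c = -d, so c = 0. In the
  application c and d are the speeds at the two ends of the curve.\<close>

lemma figT_pm_K_independent:
  assumes f: "orthonormal_pair f1 f2" and c: "0 < c"
    and eq: "c *\<^sub>R figT f1 f2 (- ellK mstar) = d *\<^sub>R figT f1 f2 (ellK mstar)"
  shows False
proof -
  have ff: "f1 \<bullet> f1 = 1" "f2 \<bullet> f2 = 1" "f1 \<bullet> f2 = 0" "f2 \<bullet> f1 = 0"
    using f by (simp_all add: orthonormal_pair_def dot_square_norm inner_commute)
  define \<alpha> where "\<alpha> = 1 - 2 * mstar"
  define \<beta> where "\<beta> = 2 * sqrt mstar * sqrt (1 - mstar)"
  have nz: "\<alpha> \<noteq> 0" "\<beta> \<noteq> 0" using mstar_gt_half mstar_less_1 by (auto simp: \<alpha>_def \<beta>_def)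
  have eq': "c *\<^sub>R (\<alpha> *\<^sub>R f1 - \<beta> *\<^sub>R f2) = d *\<^sub>R (\<alpha> *\<^sub>R f1 + \<beta> *\<^sub>R f2)"
    using eq by (simp only: figT_pm_K \<alpha>_def \<beta>_def)
  have "c * \<alpha> = d * \<alpha>"
    using arg_cong[OF eq', of "\<lambda>x. x \<bullet> f1"] by (simp add: inner_add_left inner_diff_left ff)
  moreover have "- (c * \<beta>) = d * \<beta>"
    using arg_cong[OF eq', of "\<lambda>x. x \<bullet> f2"] by (simp add: inner_add_left inner_diff_left ff)
  then have "(c + d) * \<beta> = 0" by (simp add: distrib_right)
  ultimately show False using nz c by simp
qed

text \<open>Writing the scale as 2K / l with a prescribed length l makes it literally the same for
  all leaves of that length.\<close>

lemma fig8_half_normal_form: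
  fixes \<gamma> :: "real \<Rightarrow> 'a::euclidean_space"
  assumes "fig8_elastica 1 a b \<gamma>" "continuous_on {a..b} g"
    and "\<And>t. t \<in> {a..b} \<Longrightarrow> (\<gamma> has_vector_derivative g t) (at t within {a..b})"
    and "\<And>t. t \<in> {a..b} \<Longrightarrow> g t \<noteq> 0"
    and l: "curve_length a b \<gamma> = l"
  shows "\<exists>q f1 f2. orthonormal_pair f1 f2 \<and>
    (\<forall>t\<in>{a..b}. \<gamma> t = q + (1 / (2 * ellK mstar / l)) *\<^sub>R
      figZ f1 f2 (2 * ellK mstar / l * arclength a b \<gamma> t - ellK mstar)) \<and>
    (\<forall>t\<in>{a..b}. g t = norm (g t) *\<^sub>R figT f1 f2 (2 * ellK mstar / l * arclength a b \<gamma> t - ellK mstar))"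
proof (rule fig8_elastica_normal_form[OF assms(1-4)])
  fix q f1 f2
  assume "orthonormal_pair f1 f2"
    and "\<And>t. t \<in> {a..b} \<Longrightarrow> \<gamma> t = q + (1 / (2 * ellK mstar * real 1 / curve_length a b \<gamma>)) *\<^sub>R
      figZ f1 f2 (2 * ellK mstar * real 1 / curve_length a b \<gamma> * arclength a b \<gamma> t - ellK mstar)"
    and "\<And>t. t \<in> {a..b} \<Longrightarrow> g t = norm (g t) *\<^sub>R
      figT f1 f2 (2 * ellK mstar * real 1 / curve_length a b \<gamma> * arclength a b \<gamma> t - ellK mstar)"
  then show ?thesis
    unfolding l of_nat_1 mult_1_right by (intro exI[of _ q] exI[of _ f1] exI[of _ f2]) blast
qed

lemma closed_H2_curve_shift_periodic:
  assumes "closed_H2_curve \<gamma>" shows "\<gamma> (t + 1 + t0) = \<gamma> (t + t0)"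
proof -
  have "\<gamma> ((t + t0) + 1) = \<gamma> (t + t0)" using assms by (simp add: closed_H2_curve_def)
  then show ?thesis by (simp add: algebra_simps)
qed

text \<open>By periodicity the derivative at 1 is the left derivative at 0. On [-1, 1] the base
  point is interior, so the absence of corners equates it with the right derivative.\<close>

lemma closed_H2_curve_derivative_closes:
  fixes \<gamma> :: "real \<Rightarrow> 'a::euclidean_space"
  assumes "closed_H2_curve \<gamma>"
    and D: "\<And>t. t \<in> {0..1} \<Longrightarrow> ((\<lambda>t. \<gamma> (t + t0)) has_vector_derivative g t) (at t within {0..1})"
  shows "g 0 = g 1"
proof -
  define \<delta> where "\<delta> = (\<lambda>t. \<gamma> (t + t0))"
  have per: "\<delta> (t + 1) = \<delta> t" for t
    unfolding \<delta>_def by (rule closed_H2_curve_shift_periodic[OF assms(1)])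
  have "H2_on (-1) 1 \<delta>"
    unfolding \<delta>_def using assms(1) by (intro H2_on_shift) (simp add: closed_H2_curve_def)
  moreover have "(\<delta> has_vector_derivative g 0) (at 0 within {0..1})"
    using D[of 0] by (simp add: \<delta>_def)
  moreover have "(\<delta> has_vector_derivative g 1) (at 0 within {-1..0})"
  proof -
    have "((\<lambda>t. t + 1) has_vector_derivative 1) (at 0 within {-1..0::real})"
      by (auto intro!: derivative_eq_intros)
    moreover have "(\<lambda>t. t + 1) ` {-1..0::real} = {0..1}"
      by (simp add: image_add_atLeastAtMost')
    ultimately have "(\<delta> \<circ> (\<lambda>t. t + 1) has_vector_derivative 1 *\<^sub>R g 1) (at 0 within {-1..0})"
      using D[of 1] by (intro vector_diff_chain_within) (simp_all add: \<delta>_def)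
    moreover have "\<delta> \<circ> (\<lambda>t. t + 1) = \<delta>" by (auto simp: per)
    ultimately show ?thesis by simp
  qed
  ultimately show ?thesis by (intro H2_on_no_corner[of "-1" 1 \<delta> 0]) auto
qed

section \<open>Closed curves with one leaf\<close>

lemma no_closed_1_leafed: "\<not> closed_leafed_elastica 1 \<gamma>"
proof
  assume "closed_leafed_elastica 1 \<gamma>"
  then obtain t0 x where H: "closed_H2_curve \<gamma>" and imm: "immersed_on 0 1 (\<lambda>t. \<gamma> (t + t0))"
    and fig: "fig8_elastica 1 0 1 (\<lambda>t. \<gamma> (t + t0))"
    unfolding closed_leafed_elastica_def leafed_elastica_def by auto
  define \<delta> where "\<delta> = (\<lambda>t. \<gamma> (t + t0))"
  from imm obtain g where g: "continuous_on {0..1} g"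
    and D: "\<And>t. t \<in> {0..1} \<Longrightarrow> (\<delta> has_vector_derivative g t) (at t within {0..1})"
    and nz: "\<And>t. t \<in> {0..1} \<Longrightarrow> g t \<noteq> 0"
    unfolding immersed_on_def \<delta>_def by blast
  have closes: "g 0 = g 1" by (rule closed_H2_curve_derivative_closes[OF H D[unfolded \<delta>_def]])
  have L: "curve_length 0 1 \<delta> > 0" by (rule curve_length_pos[OF _ g D nz]) auto
  obtain q f1 f2 where f: "orthonormal_pair f1 f2" and T: "\<forall>t\<in>{0..1}. g t = norm (g t) *\<^sub>R figT f1 f2
       (2 * ellK mstar / curve_length 0 1 \<delta> * arclength 0 1 \<delta> t - ellK mstar)"
    using fig8_half_normal_form[OF fig[folded \<delta>_def] g D nz refl] by blast
  \<comment> \<open>Over the leaf the phase runs from -K to K, since the scale times the length is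
    2K.\<close>
  have "g 0 = norm (g 0) *\<^sub>R figT f1 f2 (- ellK mstar)"
    using bspec[OF T, of 0] by (simp add: arclength_left)
  moreover have "g 1 = norm (g 1) *\<^sub>R figT f1 f2 (ellK mstar)"
    using bspec[OF T, of 1] L by (simp add: curve_length_def)
  ultimately have "norm (g 0) *\<^sub>R figT f1 f2 (- ellK mstar) = norm (g 1) *\<^sub>R figT f1 f2 (ellK mstar)"
    using closes by simp
  from figT_pm_K_independent[OF f _ this] show False using nz[of 0] by simp
qed

section \<open>Periodic lifts and closed curves with two leaves\<close>

lemma periodic_of_int:
  fixes f :: "real \<Rightarrow> 'a"
  assumes per: "\<And>t. f (t + 1) = f t" shows "f (t + of_int n) = f t"
proof (induction n rule: int_induct[of _ 0])
  case (step1 i) then show ?case using per[of "t + of_int i"] by (simp add: add.assoc)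
next
  case (step2 i) then show ?case using per[of "t + of_int (i - 1)"] by (simp add: algebra_simps)
qed simp

lemma periodic_frac:
  fixes f :: "real \<Rightarrow> 'a"
  assumes "\<And>t. f (t + 1) = f t" shows "f (frac t) = f t"
  using periodic_of_int[of f, OF assms, of "frac t" "\<lfloor>t\<rfloor>"] by (simp add: frac_def)

lemma periodic_eqI:
  fixes f g :: "real \<Rightarrow> 'a"
  assumes "\<And>t. f (t + 1) = f t" "\<And>t. g (t + 1) = g t" and "\<And>t. t \<in> {0..1} \<Longrightarrow> f t = g t"
  shows "f t = g t"
proof -
  have "frac t \<in> {0..1}" using frac_lt_1[of t] by (simp add: less_imp_le)
  then show ?thesis using assms(3) periodic_frac[of f, OF assms(1)] periodic_frac[of g, OF assms(2)] by metis
qed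

text \<open>Only the integers are critical. Periods on both sides of 0 glue to continuity on
  [-1, 1], where 0 is interior, and subtracting the floor brings every point into the open
  interval.\<close>

lemma continuous_on_frac_extension:
  fixes f :: "real \<Rightarrow> 'a::topological_space"
  assumes f: "continuous_on {0..1} f" and ends: "f 0 = f 1"
  shows "continuous_on UNIV (\<lambda>t. f (frac t))"
proof -
  define h where "h = (\<lambda>t. f (frac t))"
  have per: "h (t + of_int n) = h t" for t n by (simp add: h_def frac_def)
  have h01: "h t = f t" if "t \<in> {0..1}" for t
  proof (cases "t = 1")
    case False with that show ?thesis by (simp add: h_def frac_eq)
  qed (simp add: h_def ends)
  have c1: "continuous_on {0..1} h" using f by (rule continuous_on_eq) (simp add: h01)
  have "continuous_on {-1..0} (\<lambda>t. h (t + 1))"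
    by (rule continuous_on_compose2[OF c1]) (auto intro!: continuous_intros)
  then have c2: "continuous_on {-1..0} h" using per[of _ 1] by simp
  have "{-1..0} \<union> {0..1} = {-1..1::real}" by auto
  then have c3: "continuous_on {-1..1} h"
    using continuous_on_closed_Un[OF _ _ c2 c1] by simp
  show "continuous_on UNIV h"
  proof (intro continuous_at_imp_continuous_on ballI)
    fix t :: real
    have "-1 < frac t" using frac_ge_0[of t] by linarith
    then have "frac t \<in> interior {-1..1}" using frac_lt_1[of t] by (simp add: interior_atLeastAtMost_real)
    from continuous_on_interior[OF c3 this]
    have "isCont h (t - of_int \<lfloor>t\<rfloor>)" by (simp only: frac_def)
    then have "isCont (\<lambda>s. h (s - of_int \<lfloor>t\<rfloor>)) t"
      by (rule isCont_o2[where g = h and f = "\<lambda>s. s - of_int \<lfloor>t\<rfloor>", rotated]) simp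
    then show "isCont h t" using per[of _ "- \<lfloor>t\<rfloor>"] by simp
  qed
qed

text \<open>A single antiderivative of the speed thus measures all subarcs, which lets the two
  leaves and the periodic lift share one arclength function.\<close>

lemma arclength_of_antiderivative:
  fixes \<gamma> :: "real \<Rightarrow> 'a::euclidean_space"
  assumes "a < b" and g: "continuous_on {a..b} g"
    and D: "\<And>t. t \<in> {a..b} \<Longrightarrow> (\<gamma> has_vector_derivative g t) (at t within {a..b})"
    and \<sigma>: "\<And>t. t \<in> {a..b} \<Longrightarrow> (\<sigma> has_real_derivative norm (g t)) (at t within {a..b})"
    and t: "t \<in> {a..b}"
  shows "arclength a b \<gamma> t = \<sigma> t - \<sigma> a"
proof -
  have "((\<lambda>u. norm (g u)) has_integral \<sigma> t - \<sigma> a) {a..t}"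
  proof (rule fundamental_theorem_of_calculus)
    fix x assume "x \<in> {a..t}"
    then have "(\<sigma> has_real_derivative norm (g x)) (at x within {a..t})"
      using t by (intro DERIV_subset[OF \<sigma>]) auto
    then show "(\<sigma> has_vector_derivative norm (g x)) (at x within {a..t})"
      by (simp add: has_real_derivative_iff_has_vector_derivative)
  qed (use t in auto)
  then show ?thesis using arclength_eq[OF assms(1) g D t] by (simp add: integral_unique)
qed

text \<open>\<open>\<sigma>\<close> is the arclength of the lifted curve, measured from the base point.\<close>

definition closed_fig8_form ::
  "(real \<Rightarrow> 'a::euclidean_space) \<Rightarrow> real \<Rightarrow> 'a \<Rightarrow> 'a \<Rightarrow> 'a \<Rightarrow> real \<Rightarrow> (real \<Rightarrow> real) \<Rightarrow> (real \<Rightarrow> real) \<Rightarrow> bool" where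
  "closed_fig8_form \<gamma> t0 q f1 f2 \<Lambda> \<sigma> v \<longleftrightarrow> orthonormal_pair f1 f2 \<and> 0 < \<Lambda> \<and>
     (\<forall>t. \<gamma> (t + t0) = q + (1 / \<Lambda>) *\<^sub>R figZ f1 f2 (\<Lambda> * \<sigma> t - ellK mstar)) \<and>
     (\<forall>t. (\<sigma> has_real_derivative v t) (at t)) \<and> continuous_on UNIV v \<and> (\<exists>c>0. \<forall>t. c \<le> v t) \<and>
     (\<forall>t. \<sigma> (t + 1) = \<sigma> t + 4 * ellK mstar / \<Lambda>)"

text \<open>Equal lengths give both leaves the same \<Lambda>, and each begins and ends at a zero of
  \<open>figZ\<close>, so they share the centre q. The formula on [0, 1] extends to the line because
  each turn adds 4K, a period of \<open>figZ\<close>, to the phase.\<close>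

lemma closed_2_leafed_form:
  assumes "closed_leafed_elastica 2 \<gamma>"
  obtains t0 q f1 f2 \<Lambda> \<sigma> v where "closed_fig8_form \<gamma> t0 q f1 f2 \<Lambda> \<sigma> v"
proof -
  from assms obtain t0 x l where H: "closed_H2_curve \<gamma>" and imm: "immersed_on 0 1 (\<lambda>t. \<gamma> (t + t0))"
    and x: "x 0 = 0" "x 2 = 1" "\<forall>i<2. x i < x (Suc i)"
    and fig: "\<forall>i<2. fig8_elastica 1 (x i) (x (Suc i)) (\<lambda>t. \<gamma> (t + t0))"
    and len: "\<forall>i<2. curve_length (x i) (x (Suc i)) (\<lambda>t. \<gamma> (t + t0)) = l"
    unfolding closed_leafed_elastica_def leafed_elastica_def by blast
  define \<delta> where "\<delta> = (\<lambda>t. \<gamma> (t + t0))"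
  define K where "K = ellK mstar"
  define y where "y = x 1"
  have K: "0 < K" unfolding K_def by (rule ellK_pos[OF mstar_bounds])
  have y: "0 < y" "y < 1" using x by (auto simp: y_def numeral_2_eq_2)
  have fig1: "fig8_elastica 1 0 y \<delta>" and fig2: "fig8_elastica 1 y 1 \<delta>"
    and len1: "curve_length 0 y \<delta> = l" and len2: "curve_length y 1 \<delta> = l"
    using x(1,2) spec[OF fig, of 0] spec[OF fig, of 1] spec[OF len, of 0] spec[OF len, of 1]
    by (simp_all add: y_def numeral_2_eq_2 \<delta>_def)
  from imm obtain g where g: "continuous_on {0..1} g"
    and D: "\<And>t. t \<in> {0..1} \<Longrightarrow> (\<delta> has_vector_derivative g t) (at t within {0..1})"
    and nz: "\<And>t. t \<in> {0..1} \<Longrightarrow> g t \<noteq> 0"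
    unfolding immersed_on_def \<delta>_def by blast
  have closes: "g 0 = g 1" by (rule closed_H2_curve_derivative_closes[OF H D[unfolded \<delta>_def]])
  have g': "continuous_on {a..b} g"
    and D': "\<And>t. t \<in> {a..b} \<Longrightarrow> (\<delta> has_vector_derivative g t) (at t within {a..b})"
    and nz': "\<And>t. t \<in> {a..b} \<Longrightarrow> g t \<noteq> 0" if "0 \<le> a" "b \<le> 1" for a b
  proof -
    have s: "{a..b} \<subseteq> {0..1}" using that by auto
    show "continuous_on {a..b} g" by (rule continuous_on_subset[OF g s])
    fix t assume "t \<in> {a..b}"
    with s have t: "t \<in> {0..1}" by blast
    show "(\<delta> has_vector_derivative g t) (at t within {a..b})"
      by (rule has_vector_derivative_within_subset[OF D[OF t] s])
    show "g t \<noteq> 0" by (rule nz[OF t])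
  qed
  have y1: "y \<le> 1" and y0: "0 \<le> y" using y by auto
  have l: "0 < l" using curve_length_pos[OF y(1) g'[OF order_refl y1] D'[OF order_refl y1] nz'[OF order_refl y1]] len1 by simp
  \<comment> \<open>The speed is extended periodically; continuity of the extension rests on g 0 = g
    1.\<close>
  define v where "v = (\<lambda>t. norm (g (frac t)))"
  define \<sigma> where "\<sigma> = (\<lambda>t. LBINT u=0..ereal t. v u)"
  define \<Lambda> where "\<Lambda> = 2 * K / l"
  have \<Lambda>: "0 < \<Lambda>" "\<Lambda> * l = 2 * K" using K l by (auto simp: \<Lambda>_def)
  have v01: "v t = norm (g t)" if "t \<in> {0..1}" for t
  proof (cases "t = 1")
    case False with that show ?thesis by (simp add: v_def frac_eq)
  qed (simp add: v_def closes)
  have vc: "continuous_on UNIV v"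
    unfolding v_def
    by (rule continuous_on_frac_extension[of "\<lambda>t. norm (g t)"]) (auto intro: continuous_on_norm g simp: closes)
  have \<sigma>: "(\<sigma> has_real_derivative v t) (at t)" for t
    unfolding \<sigma>_def by (rule DERIV_LBINT_from_0[OF vc])
  have \<sigma>0: "\<sigma> 0 = 0" by (simp add: \<sigma>_def flip: zero_ereal_def)
  have arc: "arclength a b \<delta> t = \<sigma> t - \<sigma> a" if "0 \<le> a" "a < b" "b \<le> 1" "t \<in> {a..b}" for a b t
  proof (rule arclength_of_antiderivative[OF that(2) g'[OF that(1,3)] D'[OF that(1,3)] _ that(4)])
    fix s assume "s \<in> {a..b}"
    then have "v s = norm (g s)" using that by (intro v01) auto
    then show "(\<sigma> has_real_derivative norm (g s)) (at s within {a..b})"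
      using has_field_derivative_at_within[OF \<sigma>[of s]] by simp
  qed simp
  have \<sigma>y: "\<sigma> y = l" using arc[of 0 y y] y len1 \<sigma>0 by (simp add: curve_length_def)
  have \<sigma>1: "\<sigma> 1 = 2 * l" using arc[of y 1 1] y len2 \<sigma>y by (simp add: curve_length_def)
  have \<sigma>per: "\<sigma> (t + 1) = \<sigma> t + 2 * l" for t
  proof -
    have vp: "v (t + 1) = v t" for t by (simp add: v_def frac_1_eq)
    have "((\<lambda>t. \<sigma> (t + 1) - 2 * l) has_real_derivative v t) (at t)" for t
    proof -
      have "((\<lambda>t. t + 1) has_real_derivative 1) (at t)" by (auto intro!: derivative_eq_intros)
      from DERIV_diff[OF DERIV_chain'[OF this \<sigma>] DERIV_const] show ?thesis by (simp add: vp)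
    qed
    then have "\<sigma> (t + 1) - 2 * l = \<sigma> t"
      by (rule eq_of_same_derivative[OF _ \<sigma>, of _ 0]) (simp add: \<sigma>0 \<sigma>1)
    then show ?thesis by simp
  qed
  \<comment> \<open>The uniform lower bound on the speed is what later makes arclength invertible on
    the whole line.\<close>
  have "\<exists>c>0. \<forall>t. c \<le> v t"
  proof -
    obtain z where z: "z \<in> {0..1::real}" "\<forall>t\<in>{0..1}. norm (g z) \<le> norm (g t)"
      using continuous_attains_inf[OF compact_Icc _ continuous_on_norm[OF g]] by auto
    have "norm (g z) \<le> v t" for t
      using z(2) frac_ge_0[of t] frac_lt_1[of t] by (simp add: v_def less_imp_le)
    then show ?thesis using nz[OF z(1)] by (intro exI[of _ "norm (g z)"]) simp
  qed
  moreover
  obtain q f1 f2 where f: "orthonormal_pair f1 f2"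
    and P1: "\<forall>t\<in>{0..y}. \<delta> t = q + (1 / \<Lambda>) *\<^sub>R figZ f1 f2 (\<Lambda> * arclength 0 y \<delta> t - K)"
    and T1: "\<forall>t\<in>{0..y}. g t = norm (g t) *\<^sub>R figT f1 f2 (\<Lambda> * arclength 0 y \<delta> t - K)"
    using fig8_half_normal_form[OF fig1 g'[OF order_refl y1] D'[OF order_refl y1] nz'[OF order_refl y1] len1] unfolding K_def \<Lambda>_def by blast
  obtain r h1 h2 where h: "orthonormal_pair h1 h2"
    and P2: "\<forall>t\<in>{y..1}. \<delta> t = r + (1 / \<Lambda>) *\<^sub>R figZ h1 h2 (\<Lambda> * arclength y 1 \<delta> t - K)"
    and T2: "\<forall>t\<in>{y..1}. g t = norm (g t) *\<^sub>R figT h1 h2 (\<Lambda> * arclength y 1 \<delta> t - K)"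
    using fig8_half_normal_form[OF fig2 g'[OF y0 order_refl] D'[OF y0 order_refl] nz'[OF y0 order_refl] len2] unfolding K_def \<Lambda>_def by blast
  have arcs: "arclength 0 y \<delta> 0 = 0" "arclength y 1 \<delta> y = 0" "\<Lambda> * arclength 0 y \<delta> y = 2 * K" "\<Lambda> * arclength y 1 \<delta> 1 = 2 * K"
    using len1 len2 \<Lambda>(2) by (simp_all add: arclength_left curve_length_def)
  have ends: "g 0 = norm (g 0) *\<^sub>R figT f1 f2 (- K)" "g y = norm (g y) *\<^sub>R figT f1 f2 K"
    "g y = norm (g y) *\<^sub>R figT h1 h2 (- K)" "g 1 = norm (g 1) *\<^sub>R figT h1 h2 K"
    using bspec[OF T1, of 0] bspec[OF T1, of y] bspec[OF T2, of y] bspec[OF T2, of 1] y arcs by simp_all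
  have "norm (g y) *\<^sub>R figT f1 f2 K = norm (g y) *\<^sub>R figT h1 h2 (- K)" using ends(2,3) by simp
  then have t1: "figT f1 f2 K = figT h1 h2 (- K)" using nz[of y] y by simp
  have "norm (g 0) *\<^sub>R figT f1 f2 (- K) = norm (g 0) *\<^sub>R figT h1 h2 K" using ends(1,4) closes by simp
  then have t2: "figT f1 f2 (- K) = figT h1 h2 K" using nz[of 0] y by simp
  have h12: "h1 = f1" "h2 = - f2" using figT_pm_K_frame t1 t2 unfolding K_def by blast+
  have rq: "r = q"
    using bspec[OF P1, of y] bspec[OF P2, of y] y arcs unfolding K_def by (simp add: figZ_pm_K)
  have "\<gamma> (t + t0) = q + (1 / \<Lambda>) *\<^sub>R figZ f1 f2 (\<Lambda> * \<sigma> t - K)" for t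
  proof -
    have "\<delta> t = q + (1 / \<Lambda>) *\<^sub>R figZ f1 f2 (\<Lambda> * \<sigma> t - K)"
    proof (rule periodic_eqI[of \<delta>])
      show "\<delta> (t + 1) = \<delta> t" for t
        unfolding \<delta>_def by (rule closed_H2_curve_shift_periodic[OF H])
      \<comment> \<open>Two advances by 2K reflect the frame twice.\<close>
      have Z4: "figZ f1 f2 (u + 4 * K) = figZ f1 f2 u" for u
      proof -
        have "figZ f1 f2 (u + 2 * K + 2 * K) = figZ f1 f2 u"
          by (simp only: figZ_add_2K K_def minus_minus)
        then show ?thesis by (simp add: add.assoc)
      qed
      show "q + (1 / \<Lambda>) *\<^sub>R figZ f1 f2 (\<Lambda> * \<sigma> (t + 1) - K) = q + (1 / \<Lambda>) *\<^sub>R figZ f1 f2 (\<Lambda> * \<sigma> t - K)" for t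
      proof -
        have "\<Lambda> * \<sigma> (t + 1) - K = (\<Lambda> * \<sigma> t - K) + 4 * K" 
        proof -
          have "\<Lambda> * \<sigma> (t + 1) = \<Lambda> * \<sigma> t + 2 * (\<Lambda> * l)" unfolding \<sigma>per by (simp add: distrib_left)
          with \<Lambda>(2) show ?thesis by linarith
        qed
        then show ?thesis by (simp only: Z4)
      qed
      fix t :: real assume t: "t \<in> {0..1}"
      show "\<delta> t = q + (1 / \<Lambda>) *\<^sub>R figZ f1 f2 (\<Lambda> * \<sigma> t - K)"
      proof (cases "t \<le> y")
        case True
        then show ?thesis using bspec[OF P1, of t] arc[of 0 y t] t y \<sigma>0 by simp
      next
        case False
        then have "\<delta> t = q + (1 / \<Lambda>) *\<^sub>R figZ f1 (- f2) (\<Lambda> * (\<sigma> t - l) - K)"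
          using bspec[OF P2, of t] arc[of y 1 t] t y by (simp add: rq h12 \<sigma>y)
        \<comment> \<open>Undoing the reflection advances the phase by 2K, which equals \<Lambda> l,
          the amount lost by measuring arclength from y.\<close>
        also have "figZ f1 (- f2) (\<Lambda> * (\<sigma> t - l) - K) = figZ f1 f2 (\<Lambda> * (\<sigma> t - l) - K + 2 * K)"
          by (simp only: figZ_add_2K K_def)
        also have "\<Lambda> * (\<sigma> t - l) - K + 2 * K = \<Lambda> * \<sigma> t - K" using \<Lambda>(2) by (simp add: right_diff_distrib)
        finally show ?thesis .
      qed
    qed
    then show ?thesis by (simp add: \<delta>_def)
  qed
  moreover have "\<sigma> (t + 1) = \<sigma> t + 4 * K / \<Lambda>" for t using \<Lambda> l K by (simp add: \<sigma>per \<Lambda>_def)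
  ultimately have "closed_fig8_form \<gamma> t0 q f1 f2 \<Lambda> \<sigma> v"
    unfolding closed_fig8_form_def using f \<Lambda>(1) vc \<sigma> by (simp add: K_def)
  then show thesis by (rule that)
qed

section \<open>Uniqueness and existence of the closed figure-eight\<close>

text \<open>The Householder reflection in the hyperplane orthogonal to w. For w = 0 it is the
  identity, so vectors that already coincide need no separate treatment later.\<close>

definition reflect_in :: "'a::euclidean_space \<Rightarrow> 'a \<Rightarrow> 'a" where
  "reflect_in w x = x - (2 * (x \<bullet> w) / (w \<bullet> w)) *\<^sub>R w"

lemma orthogonal_reflect_in: "orthogonal_transformation (reflect_in w)"
  unfolding orthogonal_transformation_def
proof
  show "linear (reflect_in w)"
    by (rule linearI) (simp_all add: reflect_in_def inner_add_left algebra_simps add_divide_distrib)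
  show "\<forall>x y. reflect_in w x \<bullet> reflect_in w y = x \<bullet> y"
    by (cases "w = 0")
       (simp_all add: reflect_in_def inner_diff_left inner_diff_right inner_commute field_simps)
qed

lemma reflect_in_fixes: "x \<bullet> w = 0 \<Longrightarrow> reflect_in w x = x"
  by (simp add: reflect_in_def)

lemma reflect_in_swaps:
  assumes "norm x = norm y" shows "reflect_in (x - y) x = y"
proof (cases "x = y")
  case False
  have "x \<bullet> x = y \<bullet> y" using assms by (simp add: norm_eq)
  then have "2 * (x \<bullet> (x - y)) = (x - y) \<bullet> (x - y)"
    by (simp add: inner_diff_left inner_diff_right inner_commute)
  moreover have "(x - y) \<bullet> (x - y) \<noteq> 0" using False by simp
  ultimately have "2 * (x \<bullet> (x - y)) / ((x - y) \<bullet> (x - y)) = 1" by (metis divide_self)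
  then show ?thesis unfolding reflect_in_def by (simp only: scaleR_one) simp
qed (simp add: reflect_in_def)

text \<open>One reflection takes h1 to f1. A second takes the image of h2 to f2; it fixes f1, which
  is orthogonal to both of these vectors. This works in every dimension.\<close>

lemma orthonormal_pair_transitive:
  fixes f1 f2 h1 h2 :: "'a::euclidean_space"
  assumes f: "orthonormal_pair f1 f2" and h: "orthonormal_pair h1 h2"
  obtains Q where "orthogonal_transformation Q" "Q h1 = f1" "Q h2 = f2"
proof -
  define R where "R = reflect_in (h1 - f1)"
  have R: "orthogonal_transformation R" unfolding R_def by (rule orthogonal_reflect_in)
  have R1: "R h1 = f1" unfolding R_def using f h by (intro reflect_in_swaps) (simp add: orthonormal_pair_def)
  have "norm (R h2) = norm f2"
    using f h R by (simp add: orthonormal_pair_def orthogonal_transformation_norm)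
  then have S2: "reflect_in (R h2 - f2) (R h2) = f2" by (rule reflect_in_swaps)
  have "f1 \<bullet> R h2 = h1 \<bullet> h2"
    unfolding R1[symmetric] using R by (simp add: orthogonal_transformation_def)
  then have "f1 \<bullet> (R h2 - f2) = 0" using f h by (simp add: orthonormal_pair_def inner_diff_right)
  then have S1: "reflect_in (R h2 - f2) f1 = f1" by (rule reflect_in_fixes)
  show thesis
    by (rule that[of "reflect_in (R h2 - f2) \<circ> R"])
       (simp_all add: orthogonal_transformation_compose orthogonal_reflect_in R R1 S1 S2)
qed

section \<open>Comparison of two normal forms\<close>

text \<open>Both curves trace the same \<open>figZ\<close> in their own frame, scale and speed.
  Equating phases determines the reparameterization; what remains is an affine map taking one frame,
  centre and scale to the other.\<close>

lemma closed_fig8_form_similar: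
  fixes \<gamma> \<delta> :: "real \<Rightarrow> 'a::euclidean_space"
  assumes \<gamma>: "closed_fig8_form \<gamma> t0 q f1 f2 \<Lambda> \<sigma> v" and \<delta>: "closed_fig8_form \<delta> u0 r h1 h2 M \<tau> w"
  shows "similar_up_to_reparam \<gamma> \<delta>"
proof -
  from \<gamma> obtain c where f: "orthonormal_pair f1 f2" and \<Lambda>: "0 < \<Lambda>"
    and F: "\<And>t. \<gamma> (t + t0) = q + (1 / \<Lambda>) *\<^sub>R figZ f1 f2 (\<Lambda> * \<sigma> t - ellK mstar)"
    and \<sigma>: "\<And>t. (\<sigma> has_real_derivative v t) (at t)" "continuous_on UNIV v" "0 < c" "\<And>t. c \<le> v t"
      "\<And>t. \<sigma> (t + 1) = \<sigma> t + 4 * ellK mstar / \<Lambda>"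
    unfolding closed_fig8_form_def by blast
  from \<delta> obtain d where h: "orthonormal_pair h1 h2" and M: "0 < M"
    and H: "\<And>t. \<delta> (t + u0) = r + (1 / M) *\<^sub>R figZ h1 h2 (M * \<tau> t - ellK mstar)"
    and \<tau>: "\<And>t. (\<tau> has_real_derivative w t) (at t)" "continuous_on UNIV w" "0 < d" "\<And>t. d \<le> w t"
      "\<And>t. \<tau> (t + 1) = \<tau> t + 4 * ellK mstar / M"
    unfolding closed_fig8_form_def by blast
  obtain Q where Q: "orthogonal_transformation Q" "Q h1 = f1" "Q h2 = f2"
    by (rule orthonormal_pair_transitive[OF f h])
  have linQ: "linear Q" by (rule orthogonal_transformation_linear[OF Q(1)])
  note inv = real_expanding_diffeo[OF \<tau>(1,3,4)]
  \<comment> \<open>The solution of M \<tau>(\<psi> t) = \<Lambda> \<sigma> t, the equality of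
    phases; \<phi> then corrects for the two base points. In S, the factor M / \<Lambda> turns size
    1/M into 1/\<Lambda>, and r is sent to q.\<close>
  define \<psi> where "\<psi> = (\<lambda>t. inv \<tau> (\<Lambda> / M * \<sigma> t))"
  define \<phi> where "\<phi> = (\<lambda>t. \<psi> (t - t0) + u0)"
  define S where "S = (\<lambda>x. (M / \<Lambda>) *\<^sub>R Q x + (q - (M / \<Lambda>) *\<^sub>R Q r))"
  have S: "similarity S"
    unfolding similarity_def S_def using Q(1) \<Lambda> M by (metis divide_pos_pos)
  have D\<psi>: "(\<psi> has_real_derivative \<Lambda> / M * v t / w (\<psi> t)) (at t)" for t
    unfolding \<psi>_def using DERIV_chain'[OF DERIV_cmult[OF \<sigma>(1)] inv(3)] by (rule DERIV_cong) simp
  have D\<phi>: "(\<phi> has_real_derivative \<Lambda> / M * v (t - t0) / w (\<psi> (t - t0))) (at t)" for t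
  proof -
    have "((\<lambda>t. t - t0) has_real_derivative 1) (at t)" by (auto intro!: derivative_eq_intros)
    from DERIV_add[OF DERIV_chain'[OF this D\<psi>] DERIV_const] show ?thesis
      unfolding \<phi>_def by simp
  qed
  have wpos: "0 < w t" and vpos: "0 < v t" for t
    using \<sigma>(3) \<sigma>(4)[of t] \<tau>(3) \<tau>(4)[of t] by linarith+
  have c\<psi>: "continuous_on UNIV \<psi>"
    by (rule continuous_at_imp_continuous_on) (auto intro: DERIV_isCont[OF D\<psi>])
  have sh: "continuous_on UNIV (\<lambda>t. t - t0)" by (intro continuous_intros)
  have "continuous_on UNIV (\<lambda>t. v (t - t0))"
    by (rule continuous_on_compose2[OF \<sigma>(2) sh]) simp
  moreover have "continuous_on UNIV (\<lambda>t. w (\<psi> (t - t0)))"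
    by (rule continuous_on_compose2[OF \<tau>(2) continuous_on_compose2[OF c\<psi> sh]]) simp_all
  moreover have "w (\<psi> t) \<noteq> 0" for t using wpos[of "\<psi> t"] by simp
  ultimately have cD: "continuous_on UNIV (\<lambda>t. \<Lambda> / M * v (t - t0) / w (\<psi> (t - t0)))"
    using M by (auto intro!: continuous_on_divide continuous_on_mult_left)
  \<comment> \<open>Per turn both phases gain the same amount 4K, so the matching descends to a map
    of the circle of degree one.\<close>
  have \<psi>1: "\<psi> (t + 1) = \<psi> t + 1" for t
  proof -
    have "\<tau> (\<psi> t + 1) = \<Lambda> / M * \<sigma> (t + 1)"
    proof -
      have "\<tau> (\<psi> t + 1) = \<Lambda> / M * \<sigma> t + 4 * ellK mstar / M"
        by (simp only: \<tau>(5) \<psi>_def inv(1))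
      also have "\<dots> = \<Lambda> / M * \<sigma> (t + 1)" unfolding \<sigma>(5) using \<Lambda> by (simp add: distrib_left)
      finally show ?thesis .
    qed
    then have "\<psi> (t + 1) = inv \<tau> (\<tau> (\<psi> t + 1))" by (simp add: \<psi>_def)
    then show ?thesis by (simp add: inv(2))
  qed
  have "\<phi> (t + 1) = \<phi> t + 1" for t
    using \<psi>1[of "t - t0"] by (simp add: \<phi>_def diff_add_eq)
  then have "circle_reparam \<phi>"
    unfolding circle_reparam_def using D\<phi> cD vpos wpos \<Lambda> M
    by (intro conjI allI exI[of _ "\<lambda>t. \<Lambda> / M * v (t - t0) / w (\<psi> (t - t0))"]) simp_all
  moreover have "\<gamma> = S \<circ> \<delta> \<circ> \<phi>"
  proof
    fix t
    have "M * \<tau> (\<psi> (t - t0)) = \<Lambda> * \<sigma> (t - t0)" using M by (simp add: \<psi>_def inv(1))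
    then have "\<delta> (\<phi> t) = r + (1 / M) *\<^sub>R figZ h1 h2 (\<Lambda> * \<sigma> (t - t0) - ellK mstar)"
      by (simp add: \<phi>_def H)
    moreover have "Q (figZ h1 h2 x) = figZ f1 f2 x" for x
      by (simp add: figZ_def linear_add[OF linQ] linear_scale[OF linQ] Q(2,3))
    ultimately have "S (\<delta> (\<phi> t)) = q + (1 / \<Lambda>) *\<^sub>R figZ f1 f2 (\<Lambda> * \<sigma> (t - t0) - ellK mstar)"
      using M \<Lambda> by (simp add: S_def linear_add[OF linQ] linear_scale[OF linQ] scaleR_add_right)
    with F[of "t - t0"] show "\<gamma> t = (S \<circ> \<delta> \<circ> \<phi>) t" by simp
  qed
  ultimately show ?thesis unfolding similar_up_to_reparam_def using S by blast
qed

section \<open>Cutting a figure-eight into two leaves\<close>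

lemma fig8_curvature_half: "fig8_curvature 1 (L / 2) s = fig8_curvature 2 L s"
  by (simp add: fig8_curvature_def Let_def)

text \<open>Half of the length amounts to phase 2K, where cn changes sign.\<close>

lemma fig8_curvature_add_half:
  assumes "L \<noteq> 0" shows "fig8_curvature 2 L (s + L / 2) = - fig8_curvature 2 L s"
proof -
  define \<Lambda> where "\<Lambda> = 4 * ellK mstar / L"
  have "\<Lambda> * (s + L / 2) - ellK mstar = (\<Lambda> * s - ellK mstar) + 2 * ellK mstar"
    using assms by (simp add: \<Lambda>_def field_simps)
  then have "cn (\<Lambda> * (s + L / 2) - ellK mstar) mstar = - cn (\<Lambda> * s - ellK mstar) mstar"
    by (simp only: cn_add_2K[OF mstar_bounds])
  then show ?thesis by (simp add: fig8_curvature_def Let_def \<Lambda>_def)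
qed

lemma has_vector_derivative_shift:
  assumes "(f has_vector_derivative d) (at (s + c) within {a + c..b + c :: real})"
  shows "((\<lambda>s. f (s + c)) has_vector_derivative d) (at s within {a..b})"
proof -
  have "((\<lambda>s. s + c) has_vector_derivative 1) (at s within {a..b})"
    by (auto intro!: derivative_eq_intros)
  moreover have "(\<lambda>s. s + c) ` {a..b} = {a + c..b + c}" by (rule image_add_atLeastAtMost')
  ultimately have "(f \<circ> (\<lambda>s. s + c) has_vector_derivative 1 *\<^sub>R d) (at s within {a..b})"
    using assms by (intro vector_diff_chain_within) simp_all
  then show ?thesis by (simp add: o_def)
qed

text \<open>On a half, arclength is that of the whole curve minus its value at the left end, so
  translates of c and T are witnesses in the unchanged frame. The opposite curvature of the second
  half is absorbed by the free sign.\<close>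

lemma closed_fig8_is_2_leafed:
  fixes \<gamma> :: "real \<Rightarrow> 'a::euclidean_space"
  assumes "closed_fig8_elastica \<gamma>" shows "closed_leafed_elastica 2 \<gamma>"
proof -
  from assms obtain t0 where H: "closed_H2_curve \<gamma>" and fig: "fig8_elastica 2 0 1 (\<lambda>t. \<gamma> (t + t0))"
    unfolding closed_fig8_elastica_def by blast
  define \<delta> where "\<delta> = (\<lambda>t. \<gamma> (t + t0))"
  define L where "L = curve_length 0 1 \<delta>"
  define A where "A = arclength 0 1 \<delta>"
  from fig obtain p e1 e2 \<sigma> c T where imm: "immersed_on 0 1 \<delta>"
    and plane: "in_plane p e1 e2 0 1 \<delta>" and \<sigma>: "\<sigma> = 1 \<or> \<sigma> = -1"
    and c: "\<And>t. t \<in> {0..1} \<Longrightarrow> \<delta> t = c (A t)"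
    and dc: "\<And>s. s \<in> {0..L} \<Longrightarrow> (c has_vector_derivative T s) (at s within {0..L})"
    and dT: "\<And>s. s \<in> {0..L} \<Longrightarrow> (T has_vector_derivative (\<sigma> * fig8_curvature 2 L s) *\<^sub>R rot90 e1 e2 (T s)) (at s within {0..L})"
    unfolding fig8_elastica_def has_signed_curvature_def L_def A_def \<delta>_def by blast
  from imm obtain g where g: "continuous_on {0..1} g"
    and D: "\<And>t. t \<in> {0..1} \<Longrightarrow> (\<delta> has_vector_derivative g t) (at t within {0..1})"
    and nz: "\<And>t. t \<in> {0..1} \<Longrightarrow> g t \<noteq> 0"
    unfolding immersed_on_def by blast
  have L: "0 < L" unfolding L_def by (rule curve_length_pos[OF zero_less_one g D nz])
  have A0: "A 0 = 0" and A1: "A 1 = L" by (simp_all add: A_def L_def arclength_left curve_length_def)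
  \<comment> \<open>The cut is made at half of the length, not at half of the parameter
    interval.\<close>
  have "L / 2 \<in> {0..L}" using L by simp
  then obtain y where y01: "y \<in> {0..1}" and Ay: "A y = L / 2"
    using arclength_image[OF zero_less_one g D nz] unfolding A_def L_def by (metis imageE)
  have y: "0 < y" "y < 1" using y01 Ay A0 A1 L by (auto simp: less_le)
  have sub: "fig8_elastica 1 a b \<delta> \<and> curve_length a b \<delta> = L / 2"
    \<comment> \<open>\<epsilon> is the sign of the half relative to a standard leaf: 1 for the
      first half, -1 for the second.\<close>
    if ab: "0 \<le> a" "a < b" "b \<le> 1" and len: "A b - A a = L / 2"
      and \<epsilon>: "\<epsilon> = 1 \<or> \<epsilon> = -1" and k: "\<And>s. fig8_curvature 2 L (s + A a) = \<epsilon> * fig8_curvature 1 (L / 2) s"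
      and Aa: "0 \<le> A a" "A b \<le> L" for a b \<epsilon>
  proof -
    have s: "{a..b} \<subseteq> {0..1}" using ab by auto
    have g': "continuous_on {a..b} g" by (rule continuous_on_subset[OF g s])
    have D': "(\<delta> has_vector_derivative g t) (at t within {a..b})" if "t \<in> {a..b}" for t
      using has_vector_derivative_within_subset[OF D s] that s by blast
    have arc: "arclength a b \<delta> t = A t - A a" if "t \<in> {a..b}" for t
    proof (rule arclength_of_antiderivative[OF ab(2) g' D' _ that])
      fix u assume "u \<in> {a..b}"
      then have u: "u \<in> {0..1}" using s by blast
      show "(A has_real_derivative norm (g u)) (at u within {a..b})"
        unfolding A_def by (rule DERIV_subset[OF DERIV_arclength[OF zero_less_one g D u] s])
    qed
    have len': "curve_length a b \<delta> = L / 2" using arc[of b] ab len by (simp add: curve_length_def)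
    have "has_signed_curvature e1 e2 a b \<delta> (\<lambda>s. (\<sigma> * \<epsilon>) * fig8_curvature 1 (curve_length a b \<delta>) s)"
      unfolding has_signed_curvature_def len'
    proof (rule exI[of _ "\<lambda>s. c (s + A a)"], rule exI[of _ "\<lambda>s. T (s + A a)"], intro conjI ballI)
      fix t assume "t \<in> {a..b}"
      then show "\<delta> t = c (arclength a b \<delta> t + A a)" using arc[of t] c[of t] s by auto
    next
      fix u assume u: "u \<in> {0..L / 2}"
      have s2: "{0 + A a..L / 2 + A a} \<subseteq> {0..L}" using Aa len by auto
      have u2: "u + A a \<in> {0..L}" using u Aa len by auto
      show "((\<lambda>s. c (s + A a)) has_vector_derivative T (u + A a)) (at u within {0..L / 2})"
        by (rule has_vector_derivative_shift[OF has_vector_derivative_within_subset[OF dc[OF u2] s2]])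
      show "((\<lambda>s. T (s + A a)) has_vector_derivative
          (\<sigma> * \<epsilon> * fig8_curvature 1 (L / 2) u) *\<^sub>R rot90 e1 e2 (T (u + A a))) (at u within {0..L / 2})"
        using has_vector_derivative_shift[OF has_vector_derivative_within_subset[OF dT[OF u2] s2]]
        by (simp add: k mult.assoc)
    qed
    moreover have "in_plane p e1 e2 a b \<delta>" using plane s unfolding in_plane_def by blast
    moreover have "immersed_on a b \<delta>" unfolding immersed_on_def using g' D' nz s by blast
    moreover have "\<sigma> * \<epsilon> \<in> {1, -1}" using \<sigma> \<epsilon> by auto
    ultimately show ?thesis unfolding fig8_elastica_def using ab(2) len' by blast
  qed
  have k1: "fig8_curvature 2 L (s + A 0) = 1 * fig8_curvature 1 (L / 2) s" for s
    by (simp only: A0 fig8_curvature_half add_0_right mult_1)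
  have k2: "fig8_curvature 2 L (s + A y) = -1 * fig8_curvature 1 (L / 2) s" for s
    using L unfolding Ay fig8_curvature_half by (simp add: fig8_curvature_add_half)
  have 1: "fig8_elastica 1 0 y \<delta> \<and> curve_length 0 y \<delta> = L / 2"
    by (rule sub[OF _ _ _ _ _ k1]) (use y Ay A0 L in auto)
  have 2: "fig8_elastica 1 y 1 \<delta> \<and> curve_length y 1 \<delta> = L / 2"
    by (rule sub[OF _ _ _ _ _ k2]) (use y Ay A1 L in auto)
  define x where "x = (\<lambda>i::nat. if i = 0 then 0 else if i = 1 then y else 1)"
  have "H2_on 0 1 \<delta>"
    unfolding \<delta>_def using H by (intro H2_on_shift) (simp add: closed_H2_curve_def)
  moreover have "x 0 = 0" "x 2 = 1" "\<forall>i<2. x i < x (Suc i)"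
    "\<forall>i<2. fig8_elastica 1 (x i) (x (Suc i)) \<delta>" "\<forall>i<2. curve_length (x i) (x (Suc i)) \<delta> = L / 2"
    using y 1 2 by (auto simp: x_def less_2_cases_iff)
  ultimately have "leafed_elastica 2 0 1 \<delta>"
    unfolding leafed_elastica_def using imm by (intro conjI exI[of _ x] exI[of _ "L / 2"]) simp_all
  then show ?thesis unfolding closed_leafed_elastica_def using H \<delta>_def by blast
qed

section \<open>The explicit figure-eight\<close>

text \<open>\<open>figZ\<close> has unit speed and period 4K, so running through it with constant
  speed 4K closes up after time 1. The shift by -K starts the curve at its crossing point.\<close>

lemma closed_fig8_exists:
  fixes f1 f2 :: "'a::euclidean_space"
  assumes f: "orthonormal_pair f1 f2"
  shows "closed_fig8_elastica (\<lambda>t. figZ f1 f2 (4 * ellK mstar * t - ellK mstar))"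
proof -
  define K where "K = ellK mstar"
  have K: "0 < K" unfolding K_def by (rule ellK_pos[OF mstar_bounds])
  define \<gamma> where "\<gamma> = (\<lambda>t. figZ f1 f2 (4 * K * t - K))"
  define k where "k = (\<lambda>u. 2 * sqrt mstar * cn u mstar)"
  have rot: "rot90 f1 f2 (figT f1 f2 u) = elasA mstar u *\<^sub>R f2 - elasB mstar u *\<^sub>R f1" for u
  proof -
    have "f1 \<bullet> f1 = 1" "f2 \<bullet> f2 = 1" "f1 \<bullet> f2 = 0" "f2 \<bullet> f1 = 0"
      using f by (simp_all add: orthonormal_pair_def dot_square_norm inner_commute)
    then show ?thesis by (simp add: rot90_def figT_def inner_add_left)
  qed
  have dT: "(figT f1 f2 has_vector_derivative k u *\<^sub>R rot90 f1 f2 (figT f1 f2 u)) (at u)" for u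
  proof -
    have "((\<lambda>u. elasA mstar u *\<^sub>R f1 + elasB mstar u *\<^sub>R f2) has_vector_derivative
      (elasA mstar u *\<^sub>R 0 + (- k u * elasB mstar u) *\<^sub>R f1) + (elasB mstar u *\<^sub>R 0 + (k u * elasA mstar u) *\<^sub>R f2)) (at u)"
      unfolding k_def
      by (intro has_vector_derivative_add has_vector_derivative_scaleR has_vector_derivative_const
        DERIV_elasA[OF mstar_bounds] DERIV_elasB[OF mstar_bounds])
    then show ?thesis by (simp add: figT_def[abs_def] rot[unfolded figT_def] algebra_simps)
  qed
  have lin: "((\<lambda>t. a * t - K) has_vector_derivative a) (at t)" for a t
    by (auto intro!: derivative_eq_intros simp flip: has_real_derivative_iff_has_vector_derivative)
  \<comment> \<open>Used with a = 4K for the curve on the circle and with a = 1 for its arclength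
    parameterization.\<close>
  have dZ: "((\<lambda>t. figZ f1 f2 (a * t - K)) has_vector_derivative a *\<^sub>R figT f1 f2 (a * t - K)) (at t)" for a t
    using vector_diff_chain_at[OF lin figZ_deriv] by (simp add: o_def)
  have dT': "((\<lambda>t. figT f1 f2 (a * t - K)) has_vector_derivative
      a *\<^sub>R k (a * t - K) *\<^sub>R rot90 f1 f2 (figT f1 f2 (a * t - K))) (at t)" for a t
    using vector_diff_chain_at[OF lin dT] by (simp add: o_def)
  have dg: "(\<gamma> has_vector_derivative (4 * K) *\<^sub>R figT f1 f2 (4 * K * t - K)) (at t)" for t
    unfolding \<gamma>_def by (rule dZ)
  have dg2: "((\<lambda>t. (4 * K) *\<^sub>R figT f1 f2 (4 * K * t - K)) has_vector_derivative
      (4 * K) *\<^sub>R (4 * K) *\<^sub>R k (4 * K * t - K) *\<^sub>R rot90 f1 f2 (figT f1 f2 (4 * K * t - K))) (at t)" for t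
    by (rule bounded_linear.has_vector_derivative[OF bounded_linear_scaleR_right dT'])
  have cAB: "continuous_on UNIV (elasA mstar)" "continuous_on UNIV (elasB mstar)" "continuous_on UNIV k"
  proof -
    show "continuous_on UNIV (elasA mstar)" "continuous_on UNIV (elasB mstar)"
      by (auto intro!: continuous_at_imp_continuous_on DERIV_isCont[OF DERIV_elasA[OF mstar_bounds]]
          DERIV_isCont[OF DERIV_elasB[OF mstar_bounds]])
    have "k = (\<lambda>u. - elasY mstar u)" by (simp add: k_def elasY_def fun_eq_iff)
    moreover have "continuous_on UNIV (elasY mstar)"
      by (auto intro!: continuous_at_imp_continuous_on DERIV_isCont[OF DERIV_elasY[OF mstar_bounds]])
    ultimately show "continuous_on UNIV k" by (simp add: continuous_on_minus)
  qed
  have cl: "continuous_on UNIV (\<lambda>t. 4 * K * t - K)" by (intro continuous_intros)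
  note cc = continuous_on_compose2[OF cAB(1) cl subset_UNIV] continuous_on_compose2[OF cAB(2) cl subset_UNIV]
    continuous_on_compose2[OF cAB(3) cl subset_UNIV]
  have H2: "H2_on a b \<gamma>" for a b
    by (rule H2_on_classical[OF dg dg2]) (unfold rot, intro continuous_intros cc)
  have per: "\<gamma> (t + 1) = \<gamma> t" for t
  proof -
    have "4 * K * (t + 1) - K = (4 * K * t - K) + 2 * K + 2 * K" by (simp add: algebra_simps)
    then show ?thesis by (simp only: \<gamma>_def figZ_add_2K K_def minus_minus)
  qed
  have closed: "closed_H2_curve \<gamma>" unfolding closed_H2_curve_def using per H2 by blast
  define g where "g = (\<lambda>t. (4 * K) *\<^sub>R figT f1 f2 (4 * K * t - K))"
  have ng: "norm (g t) = 4 * K" for t using K by (simp add: g_def norm_figT[OF f])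
  have g: "continuous_on {0..1} g"
  proof (rule continuous_on_subset[OF _ subset_UNIV])
    show "continuous_on UNIV g" unfolding g_def figT_def by (intro continuous_intros cc)
  qed
  have D: "(\<gamma> has_vector_derivative g t) (at t within {0..1})" for t
    unfolding g_def by (rule has_vector_derivative_at_within[OF dg])
  have nz: "g t \<noteq> 0" for t using ng[of t] K by auto
  have arc: "arclength 0 1 \<gamma> t = 4 * K * t" if "t \<in> {0..1}" for t
    using arclength_of_antiderivative[OF zero_less_one g D _ that, of "\<lambda>t. 4 * K * t"]
    by (simp add: ng)
  have len: "curve_length 0 1 \<gamma> = 4 * K" by (simp add: curve_length_def arc)
  \<comment> \<open>For two half-folds of total length 4K the scale \<Lambda> is 1.\<close>
  have curv: "fig8_curvature 2 (4 * K) s = k (s - K)" for s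
    using K by (simp add: fig8_curvature_def k_def flip: K_def)
  have "has_signed_curvature f1 f2 0 1 \<gamma> (\<lambda>s. 1 * fig8_curvature 2 (curve_length 0 1 \<gamma>) s)"
    unfolding has_signed_curvature_def len curv
  proof (rule exI[of _ "\<lambda>s. figZ f1 f2 (1 * s - K)"], rule exI[of _ "\<lambda>s. figT f1 f2 (1 * s - K)"], intro conjI ballI)
    fix s
    show "((\<lambda>s. figZ f1 f2 (1 * s - K)) has_vector_derivative figT f1 f2 (1 * s - K)) (at s within {0..4 * K})"
      using has_vector_derivative_at_within[OF dZ[of 1 s]] by simp
    show "((\<lambda>s. figT f1 f2 (1 * s - K)) has_vector_derivative (1 * k (s - K)) *\<^sub>R rot90 f1 f2 (figT f1 f2 (1 * s - K))) (at s within {0..4 * K})"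
      using has_vector_derivative_at_within[OF dT'[of 1 s]] by simp
  next
    fix t :: real assume "t \<in> {0..1}"
    moreover have "\<gamma> t = figZ f1 f2 (4 * K * t - K)" by (simp add: \<gamma>_def)
    ultimately show "\<gamma> t = figZ f1 f2 (1 * arclength 0 1 \<gamma> t - K)" by (simp add: arc)
  qed
  moreover have "in_plane 0 f1 f2 0 1 \<gamma>"
  proof -
    have "figZ f1 f2 u \<in> span {f1, f2}" for u
      unfolding figZ_def by (intro span_add span_scale span_base) simp_all
    then show ?thesis using f unfolding in_plane_def orthonormal_pair_def \<gamma>_def by simp
  qed
  moreover have "immersed_on 0 1 \<gamma>" unfolding immersed_on_def using g D nz by blast
  ultimately have "fig8_elastica 2 0 1 \<gamma>" unfolding fig8_elastica_def by force
  then have "fig8_elastica 2 0 1 (\<lambda>t. \<gamma> (t + 0))" by simp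
  with closed show ?thesis unfolding closed_fig8_elastica_def \<gamma>_def K_def by blast
qed

text \<open>Uniqueness is expressed against an arbitrary figure-eight \<open>\<delta>\<close>; the
  existence conjunct guarantees that there is one to compare with.\<close>

theorem proposition3p6:
  assumes "CARD('n::finite) \<ge> 2"
  shows "(\<nexists>\<gamma> :: real \<Rightarrow> real ^ 'n. closed_leafed_elastica 1 \<gamma>) \<and>
    (\<exists>\<gamma> :: real \<Rightarrow> real ^ 'n. closed_fig8_elastica \<gamma>) \<and>
    (\<forall>\<gamma> :: real \<Rightarrow> real ^ 'n. closed_fig8_elastica \<gamma> \<longrightarrow> closed_leafed_elastica 2 \<gamma>) \<and>
    (\<forall>\<gamma> \<delta> :: real \<Rightarrow> real ^ 'n. closed_leafed_elastica 2 \<gamma> \<and> closed_fig8_elastica \<delta> \<longrightarrow>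
       similar_up_to_reparam \<gamma> \<delta>)"
proof (intro conjI allI impI)
  show "\<nexists>\<gamma> :: real \<Rightarrow> real ^ 'n. closed_leafed_elastica 1 \<gamma>"
    using no_closed_1_leafed by blast
  \<comment> \<open>Two distinct coordinate axes, available in dimension at least 2, span the plane
    of the figure-eight.\<close>
  obtain i j :: 'n where "i \<noteq> j"
    using assms card_le_Suc0_iff_eq[of "UNIV :: 'n set"] by auto
  then have "orthonormal_pair (axis i 1 :: real ^ 'n) (axis j 1)"
    by (simp add: orthonormal_pair_def inner_axis_axis)
  then show "\<exists>\<gamma> :: real \<Rightarrow> real ^ 'n. closed_fig8_elastica \<gamma>"
    using closed_fig8_exists by blast
  show "closed_leafed_elastica 2 \<gamma>" if "closed_fig8_elastica \<gamma>" for \<gamma> :: "real \<Rightarrow> real ^ 'n"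
    using that by (rule closed_fig8_is_2_leafed)
  fix \<gamma> \<delta> :: "real \<Rightarrow> real ^ 'n"
  assume "closed_leafed_elastica 2 \<gamma> \<and> closed_fig8_elastica \<delta>"
  then have "closed_leafed_elastica 2 \<gamma>" "closed_leafed_elastica 2 \<delta>"
    using closed_fig8_is_2_leafed by blast+
  then show "similar_up_to_reparam \<gamma> \<delta>"
    by (metis closed_2_leafed_form closed_fig8_form_similar)
qed

end
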